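(* Let $n>2$ and assume $\mathrm{D}_{2n}$ is a DCI-group. Then the number of isomorphism classes of Cayley digraphs on $\mathrm{D}_{2n}$ equals \[\mathsf{o}\big(2^{\mathrm{D}_{2n}\setminus\{1\}},\mathrm{Aut}(\mathrm{D}_{2n})\big)=\frac{1}{n\phi(n)}\sum_{t>0,\ t\mid n}\phi\!\left(\frac{n}{t}\right)\sum_{\substack{1\le r\le n-1\\ \gcd(r,n)=1}}2^{\,\mathsf{c}(U_n,a_{n,r,0})+\mathsf{c}(V_n,a_{n,r,t})},\] where $\mathsf{c}(U_n,a_{n,r,0})=\sum_{d>1,\,d\mid n}\phi(d)/|r|_d$ and $\mathsf{c}(V_n,a_{n,r,t})=\sum_{(d,\ell)}\frac{d}{\kappa(n,r,t)}\phi\!\left(\frac{|r|_n}{\ell\gcd(\kappa(d,r,t),|r|_n)}\right)$, the latter sum over pairs of positive integers $(d,\ell)$ with $d\mid n$, $\ell\mid\frac{|r|_n}{\gcd(\kappa(d,r,t),|r|_n)}$ and $\gcd(r^{\ell\kappa(d,r,t)}-1,n)=d$.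
   Context: For a finite group $R$ and $S\subseteq R\setminus\{1\}$, the Cayley digraph $\mathrm{Cay}(R,S)$ has vertex set $R$ and arcs $x\to sx$ for $x\in R$, $s\in S$. $R$ is a DCI-group if whenever $\mathrm{Cay}(R,S)\cong\mathrm{Cay}(R,T)$ for $S,T\subseteq R\setminus\{1\}$, there is $\sigma\in\mathrm{Aut}(R)$ with $S^\sigma=T$. "Number of isomorphism classes of Cayley digraphs on $R$" means the number of isomorphism classes among $\{\mathrm{Cay}(R,S):S\subseteq R\setminus\{1\}\}$; $\mathsf{o}(2^{R\setminus\{1\}},\mathrm{Aut}(R))$ is the number of orbits of $\mathrm{Aut}(R)$ on subsets of $R\setminus\{1\}$. $\mathrm{D}_{2n}=\langle u_n,v_n\mid u_n^n=1=v_n^2,\ v_nu_nv_n=u_n^{-1}\rangle$; for $\gcd(r,n)=1$, $a_{n,r,t}$ is the automorphism with $u_n^i\mapsto u_n^{ri}$, $u_n^jv_n\mapsto u_n^{rj+t}v_n$. $U_n:=\langle u_n\rangle\setminus\{1\}$, $V_n:=\{u_n^iv_n:0\le i\le n-1\}$; $\mathsf{c}(\Omega,a)$ is the number of cycles (including fixed points) of $a$ on $\Omega$. $|r|_m$ is the multiplicative order of $r$ mod $m$ ($|r|_1=1$); $S_k(x)=1+x+\cdots+x^{k-1}$, $S_0=0$; $\kappa(m,r,t)=\dfrac{m|r|_m}{\gcd(m,tS_{|r|_m}(r))}$; $\phi$ is Euler's function. *)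

theory Defs
  imports "HOL-Number_Theory.Number_Theory" "HOL-Algebra.Group"
begin

definition cay_arcs :: "('a, 'b) monoid_scheme \<Rightarrow> 'a set \<Rightarrow> ('a \<times> 'a) set" where
  "cay_arcs G S = {(x, s \<otimes>\<^bsub>G\<^esub> x) | x s. x \<in> carrier G \<and> s \<in> S}"

definition cay_isomorphic :: "('a, 'b) monoid_scheme \<Rightarrow> 'a set \<Rightarrow> 'a set \<Rightarrow> bool" where
  "cay_isomorphic G S T \<longleftrightarrow>
     (\<exists>f. bij_betw f (carrier G) (carrier G) \<and>
          (\<forall>x\<in>carrier G. \<forall>y\<in>carrier G. (x, y) \<in> cay_arcs G S \<longleftrightarrow> (f x, f y) \<in> cay_arcs G T))"

definition conn_sets :: "('a, 'b) monoid_scheme \<Rightarrow> 'a set set" where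
  "conn_sets G = {S. S \<subseteq> carrier G - {\<one>\<^bsub>G\<^esub>}}"

definition DCI_group :: "('a, 'b) monoid_scheme \<Rightarrow> bool" where
  "DCI_group G \<longleftrightarrow>
     (\<forall>S\<in>conn_sets G. \<forall>T\<in>conn_sets G.
        cay_isomorphic G S T \<longrightarrow> (\<exists>\<sigma>\<in>iso G G. \<sigma> ` S = T))"

definition num_cayley_classes :: "('a, 'b) monoid_scheme \<Rightarrow> nat" where
  "num_cayley_classes G =
     card (conn_sets G // {(S, T). S \<in> conn_sets G \<and> T \<in> conn_sets G \<and> cay_isomorphic G S T})"

definition num_aut_orbits :: "('a, 'b) monoid_scheme \<Rightarrow> nat" where
  "num_aut_orbits G =
     card (conn_sets G // {(S, T). S \<in> conn_sets G \<and> T \<in> conn_sets G \<and> (\<exists>\<sigma>\<in>iso G G. \<sigma> ` S = T)})"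

text \<open>The element u^i v^b is encoded as (i, b) with 0 \<le> i < n; b = True means a factor v.
  (u^i)(u^j v^b) = u^{i+j} v^b and (u^i v)(u^j v^b) = u^{i-j} v^{1+b}.\<close>
definition dihedral :: "nat \<Rightarrow> (nat \<times> bool) monoid" where
  "dihedral n = \<lparr> carrier = {0..<n} \<times> UNIV,
     mult = (\<lambda>(i, b) (j, c).
               if b then ((i + (n - j mod n)) mod n, \<not> c) else ((i + j) mod n, c)),
     one = (0, False) \<rparr>"

definition dih_aut :: "nat \<Rightarrow> nat \<Rightarrow> nat \<Rightarrow> nat \<times> bool \<Rightarrow> nat \<times> bool" where
  "dih_aut n r t = (\<lambda>(i, b). if b then ((r * i + t) mod n, True) else ((r * i) mod n, False))"

definition dih_U :: "nat \<Rightarrow> (nat \<times> bool) set" where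
  "dih_U n = {(i, False) | i. 0 < i \<and> i < n}"

definition dih_V :: "nat \<Rightarrow> (nat \<times> bool) set" where
  "dih_V n = {(i, True) | i. i < n}"

definition num_cycles :: "'a set \<Rightarrow> ('a \<Rightarrow> 'a) \<Rightarrow> nat" where
  "num_cycles \<Omega> a = card (\<Omega> // {(x, y). x \<in> \<Omega> \<and> y \<in> \<Omega> \<and> (\<exists>k. (a ^^ k) x = y)})"

text \<open>|r|_m: multiplicative order of r modulo m (|r|_1 = 1).\<close>
definition mord :: "nat \<Rightarrow> nat \<Rightarrow> nat" where
  "mord m r = ord m r"

definition Sgeom :: "nat \<Rightarrow> nat \<Rightarrow> nat" where
  "Sgeom k x = (\<Sum>i<k. x ^ i)"

definition kappa :: "nat \<Rightarrow> nat \<Rightarrow> nat \<Rightarrow> nat" where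
  "kappa m r t = (m * mord m r) div gcd m (t * Sgeom (mord m r) r)"

end

theory Submission
  imports Defs "HOL-Algebra.Group_Action"
begin

text \<open>
  For a DCI-group the isomorphism classes of Cayley digraphs are the orbits of the automorphism
  group on subsets, which Burnside's lemma counts: an automorphism fixes as many subsets of the
  non-identity elements as there are sets of its cycles.

  On the reflections \<open>a\<close> acts as the affine map \<open>i \<mapsto> r i + t\<close> modulo \<open>n\<close>, and its number of cycles is
  the average number of fixed points of its powers. With \<open>d = gcd (r\<^sup>k - 1, n)\<close>, the power \<open>a\<^sup>k\<close> has
  \<open>d\<close> fixed points if \<open>d\<close> divides \<open>t S\<^sub>k(r)\<close> and none otherwise; as \<open>r\<^sup>k \<equiv> 1\<close> modulo \<open>d\<close>, this
  divisibility says that \<open>\<kappa>(d,r,t)\<close> divides \<open>k\<close>. Sorting the exponents \<open>k = j \<kappa>(d,r,t)\<close> by \<open>gcd j M\<close>,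
  where \<open>M\<close> is the order modulo \<open>n\<close> of the \<open>\<kappa>(d,r,t)\<close>-th power of \<open>r\<close>, gives the stated sum. It covers a full period
  of \<open>a\<close> because any \<open>d\<close> that contributes satisfies \<open>\<kappa>(n,r,t) = lcm (\<kappa>(d,r,t), |r|\<^sub>n)\<close>.

  The formula holds for every \<open>t\<close> and depends on \<open>t\<close> only through \<open>gcd t n\<close>, which collapses the
  sum over all translations to a sum over the divisors of \<open>n\<close>.
\<close>

section \<open>Cycles of a bijection\<close>

text \<open>Names the relation hidden in \<open>num_cycles\<close>. It follows forward iterates
  only; for a permutation of a finite set this is already symmetric.\<close>

definition cycle_rel :: "'a set \<Rightarrow> ('a \<Rightarrow> 'a) \<Rightarrow> ('a \<times> 'a) set" where
  "cycle_rel \<Omega> a = {(x, y). x \<in> \<Omega> \<and> y \<in> \<Omega> \<and> (\<exists>k. (a ^^ k) x = y)}"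

lemma num_cycles_eq: "num_cycles \<Omega> a = card (\<Omega> // cycle_rel \<Omega> a)"
  by (simp add: num_cycles_def cycle_rel_def)

lemma funpow_in: "a ` \<Omega> \<subseteq> \<Omega> \<Longrightarrow> x \<in> \<Omega> \<Longrightarrow> (a ^^ k) x \<in> \<Omega>"
  by (induction k) auto

lemma funpow_cong:
  assumes "a ` \<Omega> \<subseteq> \<Omega>" "\<And>x. x \<in> \<Omega> \<Longrightarrow> a x = b x" "x \<in> \<Omega>"
  shows "(a ^^ k) x = (b ^^ k) x"
proof (induction k)
  case (Suc k)
  show ?case using funpow_in[OF assms(1,3), of k] assms(2) Suc by simp
qed simp

lemma num_cycles_cong:
  assumes "a ` \<Omega> \<subseteq> \<Omega>" "\<And>x. x \<in> \<Omega> \<Longrightarrow> a x = b x"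
  shows "num_cycles \<Omega> a = num_cycles \<Omega> b"
proof -
  have "cycle_rel \<Omega> a = cycle_rel \<Omega> b"
    using funpow_cong[OF assms] by (auto simp: cycle_rel_def)
  thus ?thesis by (simp add: num_cycles_eq)
qed

lemma funpow_multiple:
  assumes "(a ^^ p) x = x"
  shows "(a ^^ (p * j)) x = x"
  using assms by (induction j) (simp_all add: funpow_add)

text \<open>Pigeonhole: two iterates of \<open>x\<close> in the finite set coincide, and injectivity
  of the shorter iterate cancels it from both sides.\<close>

lemma exists_period:
  assumes "finite \<Omega>" "bij_betw a \<Omega> \<Omega>" "x \<in> \<Omega>"
  shows "\<exists>p>0. (a ^^ p) x = x"
proof -
  have sub: "a ` \<Omega> \<subseteq> \<Omega>" using assms by (simp add: bij_betw_def)
  have "\<not> inj_on (\<lambda>k. (a ^^ k) x) (UNIV :: nat set)"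
  proof
    assume "inj_on (\<lambda>k. (a ^^ k) x) (UNIV :: nat set)"
    moreover have "finite (range (\<lambda>k. (a ^^ k) x))"
      using funpow_in[OF sub assms(3)] assms(1) by (auto intro: finite_subset)
    ultimately show False using finite_imageD infinite_UNIV_nat by blast
  qed
  then obtain i j where ij: "i < j" "(a ^^ i) x = (a ^^ j) x"
    unfolding inj_on_def by (metis linorder_neqE_nat)
  have "(a ^^ i) ((a ^^ (j - i)) x) = (a ^^ i) x"
    using ij by (simp flip: funpow_add[THEN fun_cong, unfolded comp_def])
  moreover have "inj_on (a ^^ i) \<Omega>"
  proof (induction i)
    case (Suc i)
    have "inj_on a \<Omega>" using assms by (simp add: bij_betw_def)
    moreover have "(a ^^ i) ` \<Omega> \<subseteq> \<Omega>" using funpow_in[OF sub] by auto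
    ultimately have "inj_on (a \<circ> (a ^^ i)) \<Omega>" by (intro comp_inj_on[OF Suc]) (rule inj_on_subset)
    thus ?case by (simp add: comp_def)
  qed simp
  ultimately have "(a ^^ (j - i)) x = x"
    using funpow_in[OF sub assms(3)] assms(3) by (auto dest: inj_onD)
  thus ?thesis using ij by (intro exI[of _ "j - i"]) auto
qed

text \<open>The least positive return time divides every return time, since the remainder of a
  division by it is a smaller return time.\<close>

lemma exists_minimal_period:
  assumes "(a ^^ q) x = x" "q > 0"
  shows "\<exists>p>0. \<forall>k. (a ^^ k) x = x \<longleftrightarrow> p dvd k"
proof -
  define p where "p = (LEAST p. p > 0 \<and> (a ^^ p) x = x)"
  have p: "p > 0" "(a ^^ p) x = x"
    using LeastI[of "\<lambda>p. p > 0 \<and> (a ^^ p) x = x" q] assms by (auto simp: p_def)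
  have "p dvd k" if "(a ^^ k) x = x" for k
  proof -
    have "(a ^^ (k mod p)) x = x" using funpow_mod_eq[OF p(2)] that by simp
    hence "\<not> (0 < k mod p)"
      using not_less_Least[of "k mod p" "\<lambda>p. p > 0 \<and> (a ^^ p) x = x"] p
      by (auto simp flip: p_def)
    thus ?thesis by (simp add: mod_eq_0_iff_dvd)
  qed
  moreover have "(a ^^ k) x = x" if "p dvd k" for k
    using that funpow_multiple[OF p(2)] by auto
  ultimately show ?thesis using p by blast
qed

lemma equiv_cycle_rel:
  assumes "finite \<Omega>" "bij_betw a \<Omega> \<Omega>"
  shows "equiv \<Omega> (cycle_rel \<Omega> a)"
proof (rule equivI)
  show "cycle_rel \<Omega> a \<subseteq> \<Omega> \<times> \<Omega>" by (auto simp: cycle_rel_def)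
  show "refl_on \<Omega> (cycle_rel \<Omega> a)"
    by (auto simp: refl_on_def cycle_rel_def intro: exI[of _ 0])
  show "sym (cycle_rel \<Omega> a)"
  proof (rule symI)
    fix x y assume "(x, y) \<in> cycle_rel \<Omega> a"
    then obtain k where k: "x \<in> \<Omega>" "y \<in> \<Omega>" "(a ^^ k) x = y" by (auto simp: cycle_rel_def)
    obtain p where p: "p > 0" "(a ^^ p) x = x" using exists_period[OF assms k(1)] by blast
    \<comment> \<open>Going backwards by going forwards: after \<open>k\<close> steps, another
      \<open>p * k - k\<close> complete a whole number of periods.\<close>
    have "k \<le> p * k" using p(1) by simp
    hence "(a ^^ (p * k - k)) ((a ^^ k) x) = (a ^^ (p * k)) x"
      by (simp flip: funpow_add[THEN fun_cong, unfolded comp_def])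
    hence "(a ^^ (p * k - k)) y = x" using k funpow_multiple[OF p(2)] by simp
    thus "(y, x) \<in> cycle_rel \<Omega> a" using k by (auto simp: cycle_rel_def)
  qed
  show "trans (cycle_rel \<Omega> a)"
  proof (rule transI)
    fix x y z assume "(x, y) \<in> cycle_rel \<Omega> a" "(y, z) \<in> cycle_rel \<Omega> a"
    then obtain k l where "x \<in> \<Omega>" "z \<in> \<Omega>" "(a ^^ k) x = y" "(a ^^ l) y = z"
      by (auto simp: cycle_rel_def)
    moreover from this have "(a ^^ (l + k)) x = z" by (simp add: funpow_add)
    ultimately show "(x, z) \<in> cycle_rel \<Omega> a" by (auto simp: cycle_rel_def)
  qed
qed

text \<open>The first \<open>p\<close> iterates exhaust the cycle. They are distinct, because a
  coincidence at \<open>i < j\<close> gives the return time \<open>p - j + i\<close>, which lies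
  strictly between 0 and \<open>p\<close>.\<close>

lemma card_cycle:
  assumes "a ` \<Omega> \<subseteq> \<Omega>" "x \<in> \<Omega>" "p > 0" "\<And>k. (a ^^ k) x = x \<longleftrightarrow> p dvd k"
  shows "card (cycle_rel \<Omega> a `` {x}) = p"
proof -
  have px: "(a ^^ p) x = x" using assms by simp
  have "cycle_rel \<Omega> a `` {x} = (\<lambda>k. (a ^^ k) x) ` {..<p}"
  proof (intro equalityI subsetI)
    fix y assume "y \<in> cycle_rel \<Omega> a `` {x}"
    then obtain k where "y = (a ^^ k) x" by (auto simp: cycle_rel_def)
    hence "y = (a ^^ (k mod p)) x" using funpow_mod_eq[OF px] by simp
    thus "y \<in> (\<lambda>k. (a ^^ k) x) ` {..<p}" using assms(3) by auto
  qed (use funpow_in[OF assms(1,2)] assms(2) in \<open>auto simp: cycle_rel_def\<close>)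
  moreover have "inj_on (\<lambda>k. (a ^^ k) x) {..<p}"
  proof (rule linorder_inj_onI)
    fix i j assume ij: "i < j" "i \<in> {..<p}" "j \<in> {..<p}"
    show "(a ^^ i) x \<noteq> (a ^^ j) x"
    proof
      assume "(a ^^ i) x = (a ^^ j) x"
      hence "(a ^^ (p - j)) ((a ^^ i) x) = (a ^^ (p - j)) ((a ^^ j) x)" by simp
      hence "(a ^^ (p - j + i)) x = (a ^^ (p - j + j)) x" by (simp only: funpow_add comp_def)
      hence "(a ^^ (p - j + i)) x = x" using px ij by simp
      hence "p dvd p - j + i" using assms(4) by simp
      thus False using ij by (auto dest: dvd_imp_le)
    qed
  qed auto
  ultimately show ?thesis by (simp add: card_image)
qed

text \<open>A cycle of length \<open>p\<close> consists of \<open>p\<close> points of weight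
  \<open>1 / p\<close>, so each cycle has total weight 1.\<close>

lemma num_cycles_eq_sum_inverse_period:
  assumes "finite \<Omega>" "bij_betw a \<Omega> \<Omega>"
    and per: "\<And>x. x \<in> \<Omega> \<Longrightarrow> per x > 0" "\<And>x k. x \<in> \<Omega> \<Longrightarrow> (a ^^ k) x = x \<longleftrightarrow> per x dvd k"
  shows "real (num_cycles \<Omega> a) = (\<Sum>x\<in>\<Omega>. 1 / real (per x))"
proof -
  let ?R = "cycle_rel \<Omega> a"
  have sub: "a ` \<Omega> \<subseteq> \<Omega>" using assms by (simp add: bij_betw_def)
  note eq = equiv_cycle_rel[OF assms(1,2)]
  have fin: "finite C" if "C \<in> \<Omega> // ?R" for C
    using that assms(1) finite_equiv_class[OF assms(1) equiv_type[OF eq]] by blast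
  have "(\<Sum>x\<in>\<Omega>. 1 / real (per x)) = (\<Sum>C\<in>\<Omega> // ?R. \<Sum>x\<in>C. 1 / real (per x))"
    using sum.Union_disjoint[of "\<Omega> // ?R" "\<lambda>x. 1 / real (per x)"] fin quotient_disj[OF eq]
    by (auto simp: Union_quotient[OF eq])
  also have "\<dots> = (\<Sum>C\<in>\<Omega> // ?R. 1)"
  proof (rule sum.cong)
    fix C assume C: "C \<in> \<Omega> // ?R"
    have "per x = card C" if "x \<in> C" for x
    proof -
      have x: "x \<in> \<Omega>" using that C eq by (metis Union_quotient UnionI)
      have "C = ?R `` {x}" using C that eq
        by (metis Image_singleton_iff equiv_class_eq quotientE)
      thus ?thesis using card_cycle[OF sub x] per[OF x] by simp
    qed
    hence "(\<Sum>x\<in>C. 1 / real (per x)) = real (card C) * (1 / real (card C))" by simp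
    moreover have "card C > 0"
      using fin[OF C] in_quotient_imp_non_empty[OF eq C] by (simp add: card_gt_0_iff)
    ultimately show "(\<Sum>x\<in>C. 1 / real (per x)) = 1" by simp
  qed simp
  finally show ?thesis by (simp add: num_cycles_eq)
qed

lemma card_multiples:
  assumes "(N :: nat) > 0" "p dvd N"
  shows "real (card {k \<in> {1..N}. p dvd k}) = real N / real p"
proof -
  obtain q where q: "N = p * q" using assms by auto
  have "{k \<in> {1..N}. p dvd k} = (\<lambda>j. p * j) ` {1..q}"
    using assms by (auto simp: q elim!: dvdE)
  moreover have "inj_on (\<lambda>j. p * j) {1..q}" using assms q by (auto simp: inj_on_def)
  ultimately show ?thesis using assms q by (simp add: card_image)
qed

text \<open>Burnside for the cyclic group generated by \<open>a\<close>. A point of period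
  \<open>p\<close> is fixed by \<open>N / p\<close> of the exponents from 1 to \<open>N\<close>;
  counting the pairs of exponent and fixed point both ways turns the inverse periods into an
  average.\<close>

lemma num_cycles_eq_average_fixpoints:
  assumes "finite \<Omega>" "bij_betw a \<Omega> \<Omega>" "N > 0" "\<And>x. x \<in> \<Omega> \<Longrightarrow> (a ^^ N) x = x"
  shows "real (num_cycles \<Omega> a) = (\<Sum>k=1..N. real (card {x \<in> \<Omega>. (a ^^ k) x = x})) / real N"
proof -
  have "\<forall>x\<in>\<Omega>. \<exists>p>0. \<forall>k. (a ^^ k) x = x \<longleftrightarrow> p dvd k"
    using exists_minimal_period[of N a] assms(3,4) by simp
  then obtain per where per: "\<And>x. x \<in> \<Omega> \<Longrightarrow> per x > 0"
      "\<And>x k. x \<in> \<Omega> \<Longrightarrow> (a ^^ k) x = x \<longleftrightarrow> per x dvd k"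
    by metis
  have "real (num_cycles \<Omega> a) = (\<Sum>x\<in>\<Omega>. 1 / real (per x))"
    by (intro num_cycles_eq_sum_inverse_period assms(1,2) per)
  also have "\<dots> = (\<Sum>x\<in>\<Omega>. real (card {k \<in> {1..N}. (a ^^ k) x = x}) / real N)"
  proof (rule sum.cong)
    fix x assume x: "x \<in> \<Omega>"
    hence "per x dvd N" using per assms by simp
    thus "1 / real (per x) = real (card {k \<in> {1..N}. (a ^^ k) x = x}) / real N"
      using card_multiples[OF assms(3)] assms(3) per(2)[OF x] by simp
  qed simp
  also have "\<dots> = real (\<Sum>x\<in>\<Omega>. card {k \<in> {1..N}. (a ^^ k) x = x}) / real N"
    by (simp add: sum_divide_distrib)
  also have "(\<Sum>x\<in>\<Omega>. card {k \<in> {1..N}. (a ^^ k) x = x}) = (\<Sum>k=1..N. card {x \<in> \<Omega>. (a ^^ k) x = x})"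
    by (rule sum_multicount_gen) (auto simp: assms)
  finally show ?thesis by simp
qed

text \<open>The sum of inverse periods is visibly additive, which avoids comparing the three
  quotients.\<close>

lemma num_cycles_Un:
  assumes "finite A" "finite B" "A \<inter> B = {}" "bij_betw a A A" "bij_betw a B B"
  shows "num_cycles (A \<union> B) a = num_cycles A a + num_cycles B a"
proof -
  have bij: "bij_betw a (A \<union> B) (A \<union> B)" using assms by (intro bij_betw_combine)
  have fin: "finite (A \<union> B)" using assms by simp
  \<comment> \<open>One period function serves the union and both parts, as the period of a point
    depends on \<open>a\<close> alone.\<close>
  define per where "per x = (SOME p. p > 0 \<and> (\<forall>k. (a ^^ k) x = x \<longleftrightarrow> p dvd k))" for x
  have per: "per x > 0 \<and> (\<forall>k. (a ^^ k) x = x \<longleftrightarrow> per x dvd k)" if "x \<in> A \<union> B" for x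
  proof -
    have "\<exists>p>0. \<forall>k. (a ^^ k) x = x \<longleftrightarrow> p dvd k"
      using exists_period[OF fin bij that] exists_minimal_period by metis
    thus ?thesis unfolding per_def by (rule someI_ex)
  qed
  have "real (num_cycles (A \<union> B) a) = (\<Sum>x\<in>A \<union> B. 1 / real (per x))"
    using per by (intro num_cycles_eq_sum_inverse_period fin bij) blast+
  also have "\<dots> = (\<Sum>x\<in>A. 1 / real (per x)) + (\<Sum>x\<in>B. 1 / real (per x))"
    using assms by (intro sum.union_disjoint)
  also have "(\<Sum>x\<in>A. 1 / real (per x)) = real (num_cycles A a)"
    using per by (intro num_cycles_eq_sum_inverse_period[symmetric] assms) blast+
  also have "(\<Sum>x\<in>B. 1 / real (per x)) = real (num_cycles B a)"
    using per by (intro num_cycles_eq_sum_inverse_period[symmetric] assms) blast+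
  finally show ?thesis by linarith
qed

text \<open>An invariant set is the union of the cycles that it meets, and distinct sets of cycles
  have distinct unions.\<close>

lemma card_invariant_subsets:
  assumes "finite \<Omega>" "bij_betw a \<Omega> \<Omega>"
  shows "card {S. S \<subseteq> \<Omega> \<and> a ` S = S} = 2 ^ num_cycles \<Omega> a"
proof -
  let ?R = "cycle_rel \<Omega> a"
  have sub: "a ` \<Omega> \<subseteq> \<Omega>" using assms by (simp add: bij_betw_def)
  note eq = equiv_cycle_rel[OF assms]
  have cls_sub: "C \<subseteq> \<Omega>" if "C \<in> \<Omega> // ?R" for C
    using that eq Union_quotient by blast
  have "bij_betw Union (Pow (\<Omega> // ?R)) {S. S \<subseteq> \<Omega> \<and> a ` S = S}"
  proof (rule bij_betwI')
    fix X Y assume X: "X \<in> Pow (\<Omega> // ?R)" and Y: "Y \<in> Pow (\<Omega> // ?R)"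
    have *: "C \<in> Z" if Z: "Z \<in> Pow (\<Omega> // ?R)" "C \<in> \<Omega> // ?R" "C \<subseteq> \<Union>Z" for C Z
    proof -
      obtain x where x: "x \<in> C" using in_quotient_imp_non_empty[OF eq Z(2)] by blast
      then obtain D where D: "D \<in> Z" "x \<in> D" using Z(3) by blast
      hence "C = D" using quotient_disj[OF eq Z(2), of D] Z(1) x by blast
      thus ?thesis using D by simp
    qed
    have "X \<subseteq> Y" if "\<Union>X = \<Union>Y"
      using *[OF Y] X that by (metis Pow_iff Union_upper subset_eq)
    moreover have "Y \<subseteq> X" if "\<Union>X = \<Union>Y"
      using *[OF X] Y that by (metis Pow_iff Union_upper subset_eq)
    ultimately show "\<Union>X = \<Union>Y \<longleftrightarrow> X = Y" by blast
  next
    fix X assume X: "X \<in> Pow (\<Omega> // ?R)"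
    have "\<Union>X \<subseteq> \<Omega>" using X cls_sub by blast
    moreover have "a ` \<Union>X \<subseteq> \<Union>X"
    proof
      fix y assume "y \<in> a ` \<Union>X"
      then obtain x C where x: "y = a x" "x \<in> C" "C \<in> X" by blast
      hence C: "C \<in> \<Omega> // ?R" "x \<in> \<Omega>" using X cls_sub by blast+
      have "(x, a x) \<in> ?R" using C(2) sub by (auto simp: cycle_rel_def intro!: exI[of _ 1])
      hence "a x \<in> C" using C(1) x(2) eq by (metis in_quotient_imp_closed)
      thus "y \<in> \<Union>X" using x by blast
    qed
    \<comment> \<open>An injective map of a finite set into itself is onto.\<close>
    ultimately have "a ` \<Union>X = \<Union>X"
      using assms by (intro card_subset_eq)
        (auto simp: bij_betw_def intro: finite_subset card_image inj_on_subset)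
    with \<open>\<Union>X \<subseteq> \<Omega>\<close> show "\<Union>X \<in> {S. S \<subseteq> \<Omega> \<and> a ` S = S}" by simp
  next
    fix S assume "S \<in> {S. S \<subseteq> \<Omega> \<and> a ` S = S}"
    hence S: "S \<subseteq> \<Omega>" "a ` S \<subseteq> S" by auto
    have "S = \<Union>((\<lambda>x. ?R `` {x}) ` S)"
    proof (intro equalityI subsetI)
      fix y assume "y \<in> \<Union>((\<lambda>x. ?R `` {x}) ` S)"
      then obtain x k where "x \<in> S" "y = (a ^^ k) x" by (auto simp: cycle_rel_def)
      thus "y \<in> S" using funpow_in[OF S(2)] by simp
    qed (use S equiv_class_self[OF eq] in blast)
    moreover have "(\<lambda>x. ?R `` {x}) ` S \<in> Pow (\<Omega> // ?R)" using S by (auto intro: quotientI)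
    ultimately show "\<exists>X\<in>Pow (\<Omega> // ?R). S = \<Union>X" by blast
  qed
  hence "card {S. S \<subseteq> \<Omega> \<and> a ` S = S} = card (Pow (\<Omega> // ?R))"
    by (rule bij_betw_same_card[symmetric])
  also have "\<dots> = 2 ^ num_cycles \<Omega> a"
    using finite_quotient[OF assms(1) equiv_type[OF eq]] by (simp add: card_Pow num_cycles_eq)
  finally show ?thesis .
qed

section \<open>Orbits of the automorphism group on connection sets\<close>

text \<open>The group automorphism is itself the digraph isomorphism: the arc from \<open>x\<close>
  to \<open>s x\<close> goes to the arc from \<open>\<sigma> x\<close> to \<open>\<sigma> s\<close>
  times \<open>\<sigma> x\<close>. This is the implication that holds in every group; the DCI
  property is its converse.\<close>

lemma (in group) iso_imp_cay_isomorphic: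
  assumes "\<sigma> \<in> iso G G" "S \<subseteq> carrier G"
  shows "cay_isomorphic G S (\<sigma> ` S)"
proof -
  have bij: "bij_betw \<sigma> (carrier G) (carrier G)" and hom: "\<sigma> \<in> hom G G"
    using assms(1) by (auto simp: iso_def)
  have "(x, y) \<in> cay_arcs G S \<longleftrightarrow> (\<sigma> x, \<sigma> y) \<in> cay_arcs G (\<sigma> ` S)"
    if x: "x \<in> carrier G" and y: "y \<in> carrier G" for x y
  proof -
    have "(\<sigma> x, \<sigma> y) \<in> cay_arcs G (\<sigma> ` S) \<longleftrightarrow> (\<exists>s\<in>S. \<sigma> y = \<sigma> s \<otimes> \<sigma> x)"
      using hom_in_carrier[OF hom x] by (auto simp: cay_arcs_def)
    also have "\<dots> \<longleftrightarrow> (\<exists>s\<in>S. \<sigma> y = \<sigma> (s \<otimes> x))"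
      using hom_mult[OF hom] x assms(2) by (auto intro!: bex_cong)
    also have "\<dots> \<longleftrightarrow> (\<exists>s\<in>S. y = s \<otimes> x)"
      using bij x y assms(2) by (auto simp: bij_betw_def inj_on_eq_iff subset_iff intro!: bex_cong)
    also have "\<dots> \<longleftrightarrow> (x, y) \<in> cay_arcs G S" using x by (auto simp: cay_arcs_def)
    finally show ?thesis by simp
  qed
  thus ?thesis using bij unfolding cay_isomorphic_def by blast
qed

lemma (in group) num_cayley_classes_eq_num_aut_orbits:
  assumes "DCI_group G"
  shows "num_cayley_classes G = num_aut_orbits G"
proof -
  have "cay_isomorphic G S T \<longleftrightarrow> (\<exists>\<sigma>\<in>iso G G. \<sigma> ` S = T)"
    if "S \<in> conn_sets G" "T \<in> conn_sets G" for S T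
  proof
    assume "cay_isomorphic G S T"
    thus "\<exists>\<sigma>\<in>iso G G. \<sigma> ` S = T" using that assms unfolding DCI_group_def by blast
  next
    have "S \<subseteq> carrier G" using that by (auto simp: conn_sets_def)
    thus "cay_isomorphic G S T" if "\<exists>\<sigma>\<in>iso G G. \<sigma> ` S = T"
      using iso_imp_cay_isomorphic that by blast
  qed
  hence "{(S, T). S \<in> conn_sets G \<and> T \<in> conn_sets G \<and> cay_isomorphic G S T} =
      {(S, T). S \<in> conn_sets G \<and> T \<in> conn_sets G \<and> (\<exists>\<sigma>\<in>iso G G. \<sigma> ` S = T)}"
    by auto
  thus ?thesis by (simp add: num_cayley_classes_def num_aut_orbits_def)
qed

section \<open>Burnside's lemma for automorphisms acting on connection sets\<close>

lemma (in group) auto_bij_betw: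
  assumes "\<sigma> \<in> auto G"
  shows "bij_betw \<sigma> (carrier G - {\<one>}) (carrier G - {\<one>})"
proof -
  have bij: "bij_betw \<sigma> (carrier G) (carrier G)" and hom: "\<sigma> \<in> hom G G"
    using assms by (auto simp: auto_def Bij_def)
  have "\<sigma> \<one> = \<one>" by (rule hom_one[OF hom]) unfold_locales
  thus ?thesis using bij bij_betw_DiffI[OF bij, of "{\<one>}" "{\<one>}"] by (simp add: bij_betw_def)
qed

lemma (in group) auto_image_conn_sets:
  assumes "\<sigma> \<in> auto G" "S \<in> conn_sets G"
  shows "\<sigma> ` S \<in> conn_sets G"
  using auto_bij_betw[OF assms(1)] assms(2) by (auto simp: conn_sets_def bij_betw_def)

text \<open>Members of \<open>Bij\<close> must be extensional, hence the restricted image maps.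
  Composition in \<open>AutoGroup\<close> is \<open>compose\<close> on the carrier, which agrees
  with plain composition on every connection set.\<close>

lemma (in group) group_action_conn_sets:
  "group_action (AutoGroup G) (conn_sets G) (\<lambda>\<sigma>. \<lambda>S\<in>conn_sets G. \<sigma> ` S)"
proof -
  let ?\<phi> = "\<lambda>\<sigma>. \<lambda>S\<in>conn_sets G. \<sigma> ` S"
  have carr: "carrier (AutoGroup G) = auto G" by (simp add: AutoGroup_def)
  have Bij: "?\<phi> \<sigma> \<in> Bij (conn_sets G)" if \<sigma>: "\<sigma> \<in> auto G" for \<sigma>
  proof -
    have "bij_betw (image \<sigma>) (conn_sets G) (conn_sets G)"
      using bij_betw_Pow[OF auto_bij_betw[OF \<sigma>]] by (simp add: conn_sets_def Pow_def)
    thus ?thesis by (simp add: Bij_def)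
  qed
  have mult: "?\<phi> (\<sigma> \<otimes>\<^bsub>AutoGroup G\<^esub> \<tau>) = ?\<phi> \<sigma> \<otimes>\<^bsub>BijGroup (conn_sets G)\<^esub> ?\<phi> \<tau>"
    if \<sigma>: "\<sigma> \<in> auto G" and \<tau>: "\<tau> \<in> auto G" for \<sigma> \<tau>
  proof -
    have "\<sigma> \<otimes>\<^bsub>AutoGroup G\<^esub> \<tau> = compose (carrier G) \<sigma> \<tau>"
      using \<sigma> \<tau> by (simp add: AutoGroup_def BijGroup_def auto_def)
    moreover have "?\<phi> (compose (carrier G) \<sigma> \<tau>) = compose (conn_sets G) (?\<phi> \<sigma>) (?\<phi> \<tau>)"
    proof
      fix S
      show "?\<phi> (compose (carrier G) \<sigma> \<tau>) S = compose (conn_sets G) (?\<phi> \<sigma>) (?\<phi> \<tau>) S"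
      proof (cases "S \<in> conn_sets G")
        case True
        hence "S \<subseteq> carrier G" by (auto simp: conn_sets_def)
        hence "compose (carrier G) \<sigma> \<tau> ` S = \<sigma> ` \<tau> ` S"
          by (auto simp: compose_def image_iff subset_iff)
        thus ?thesis using True auto_image_conn_sets[OF \<tau>] by (simp add: compose_def)
      qed (simp add: compose_def)
    qed
    ultimately show ?thesis using Bij[OF \<sigma>] Bij[OF \<tau>] by (simp add: BijGroup_def)
  qed
  have "?\<phi> \<in> hom (AutoGroup G) (BijGroup (conn_sets G))"
    using Bij mult by (intro homI) (simp_all add: carr BijGroup_def)
  thus ?thesis
    using AutoGroup group_BijGroup
    by (simp add: group_action_def group_hom_def group_hom_axioms_def)
qed

text \<open>\<open>iso G G\<close> also contains functions that differ only off the carrier, while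
  \<open>auto G\<close> keeps one extensional representative of each. Images of subsets of the
  carrier do not see the difference, so the orbits agree.\<close>

lemma (in group) num_aut_orbits_eq_card_orbits:
  "num_aut_orbits G = card (orbits (AutoGroup G) (conn_sets G) (\<lambda>\<sigma>. \<lambda>S\<in>conn_sets G. \<sigma> ` S))"
proof -
  let ?R = "{(S, T). S \<in> conn_sets G \<and> T \<in> conn_sets G \<and> (\<exists>\<sigma>\<in>iso G G. \<sigma> ` S = T)}"
  have "?R `` {S} = orbit (AutoGroup G) (\<lambda>\<sigma>. \<lambda>S\<in>conn_sets G. \<sigma> ` S) S" if S: "S \<in> conn_sets G" for S
  proof -
    have sub: "S \<subseteq> carrier G" using S by (auto simp: conn_sets_def)
    have *: "T \<in> conn_sets G \<and> (\<exists>\<sigma>\<in>iso G G. \<sigma> ` S = T) \<longleftrightarrow> (\<exists>\<sigma>\<in>auto G. \<sigma> ` S = T)" for T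
    proof
      assume "T \<in> conn_sets G \<and> (\<exists>\<sigma>\<in>iso G G. \<sigma> ` S = T)"
      then obtain \<sigma> where \<sigma>: "\<sigma> \<in> iso G G" "\<sigma> ` S = T" by blast
      have "restrict \<sigma> (carrier G) \<in> auto G"
        using \<sigma>(1) by (auto simp: auto_def Bij_def iso_def hom_def Pi_def)
      moreover have "restrict \<sigma> (carrier G) ` S = T" unfolding \<sigma>(2)[symmetric]
        using sub by (intro image_cong) auto
      ultimately show "\<exists>\<sigma>\<in>auto G. \<sigma> ` S = T" by blast
    next
      assume "\<exists>\<sigma>\<in>auto G. \<sigma> ` S = T"
      then obtain \<sigma> where \<sigma>: "\<sigma> \<in> auto G" "\<sigma> ` S = T" by blast
      hence "\<sigma> \<in> iso G G" by (simp add: auto_def Bij_def iso_def)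
      thus "T \<in> conn_sets G \<and> (\<exists>\<sigma>\<in>iso G G. \<sigma> ` S = T)"
        using auto_image_conn_sets[OF \<sigma>(1) S] \<sigma>(2) by blast
    qed
    have "?R `` {S} = {T. T \<in> conn_sets G \<and> (\<exists>\<sigma>\<in>iso G G. \<sigma> ` S = T)}"
      using S by simp
    also have "\<dots> = {T. \<exists>\<sigma>\<in>auto G. \<sigma> ` S = T}" by (simp only: *)
    also have "\<dots> = orbit (AutoGroup G) (\<lambda>\<sigma>. \<lambda>S\<in>conn_sets G. \<sigma> ` S) S"
      using S unfolding orbit_def AutoGroup_def by auto
    finally show ?thesis .
  qed
  hence "conn_sets G // ?R = orbits (AutoGroup G) (conn_sets G) (\<lambda>\<sigma>. \<lambda>S\<in>conn_sets G. \<sigma> ` S)"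
    unfolding quotient_def orbits_def by (simp add: Setcompr_eq_image UNION_singleton_eq_range cong: image_cong)
  thus ?thesis by (simp add: num_aut_orbits_def)
qed

lemma (in group) burnside_num_aut_orbits:
  assumes "finite (carrier G)"
  shows "num_aut_orbits G * card (auto G) = (\<Sum>\<sigma>\<in>auto G. 2 ^ num_cycles (carrier G - {\<one>}) \<sigma>)"
proof -
  let ?\<phi> = "\<lambda>\<sigma>. \<lambda>S\<in>conn_sets G. \<sigma> ` S"
  interpret act: group_action "AutoGroup G" "conn_sets G" ?\<phi> by (rule group_action_conn_sets)
  have carr: "carrier (AutoGroup G) = auto G" by (simp add: AutoGroup_def)
  have "auto G \<subseteq> carrier G \<rightarrow>\<^sub>E carrier G"
    by (auto simp: auto_def Bij_def hom_def PiE_def)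
  hence "finite (auto G)" by (rule finite_subset) (simp add: finite_PiE assms)
  moreover have "finite (conn_sets G)"
    using assms by (simp add: conn_sets_def)
  ultimately have "num_aut_orbits G * card (auto G) = (\<Sum>\<sigma>\<in>auto G. card (invariants (conn_sets G) ?\<phi> \<sigma>))"
    using act.burnside by (simp add: carr num_aut_orbits_eq_card_orbits order_def)
  also have "\<dots> = (\<Sum>\<sigma>\<in>auto G. 2 ^ num_cycles (carrier G - {\<one>}) \<sigma>)"
  proof (rule sum.cong)
    fix \<sigma> assume \<sigma>: "\<sigma> \<in> auto G"
    have "invariants (conn_sets G) ?\<phi> \<sigma> = {S. S \<subseteq> carrier G - {\<one>} \<and> \<sigma> ` S = S}"
      by (auto simp: invariants_def conn_sets_def)
    thus "card (invariants (conn_sets G) ?\<phi> \<sigma>) = 2 ^ num_cycles (carrier G - {\<one>}) \<sigma>"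
      using card_invariant_subsets[OF _ auto_bij_betw[OF \<sigma>]] assms by simp
  qed simp
  finally show ?thesis .
qed

section \<open>Geometric sums and linear congruences\<close>

lemma Sgeom_Suc: "Sgeom (Suc k) x = 1 + x * Sgeom k x"
  by (simp add: Sgeom_def sum.lessThan_Suc_shift sum_distrib_left del: sum.lessThan_Suc)

lemma Sgeom_add: "Sgeom (k + m) x = Sgeom k x + x ^ k * Sgeom m x"
  by (induction m) (simp_all add: Sgeom_def power_add algebra_simps)

text \<open>The \<open>k * j\<close> terms fall into \<open>j\<close> blocks of length
  \<open>k\<close>; modulo \<open>d\<close> each block equals the first one because
  \<open>x ^ k\<close> is 1.\<close>

lemma Sgeom_mult_cong:
  assumes "[x ^ k = 1] (mod d)"
  shows "[Sgeom (k * j) x = j * Sgeom k x] (mod d)"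
proof (induction j)
  case 0
  show ?case by (simp add: Sgeom_def)
next
  case (Suc j)
  have "[Sgeom k x + x ^ k * Sgeom (k * j) x = Sgeom k x + 1 * (j * Sgeom k x)] (mod d)"
    by (intro cong_add cong_mult cong_refl assms Suc)
  thus ?case by (simp add: Sgeom_add)
qed

lemma dvd_mult_iff_div_gcd_dvd:
  fixes n c j :: nat
  assumes "n > 0"
  shows "n dvd c * j \<longleftrightarrow> n div gcd n c dvd j"
proof -
  let ?g = "gcd n c"
  have "n = ?g * (n div ?g)" "c = ?g * (c div ?g)" by simp_all
  hence "n dvd c * j \<longleftrightarrow> ?g * (n div ?g) dvd ?g * (c div ?g * j)"
    by (metis mult.assoc)
  also have "\<dots> \<longleftrightarrow> n div ?g dvd c div ?g * j"
    using assms by (intro nat_mult_dvd_cancel1) simp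
  also have "\<dots> \<longleftrightarrow> n div ?g dvd j"
    using assms by (intro coprime_dvd_mult_right_iff div_gcd_coprime) auto
  finally show ?thesis .
qed

text \<open>Identifies \<open>kappa d r t\<close> as the order of the affine map sending
  \<open>i\<close> to \<open>r i + t\<close> modulo \<open>d\<close>: the right-hand side says that
  its \<open>k\<close>-th iterate is the identity. The power condition forces
  \<open>k = e * j\<close> with \<open>e\<close> the order of \<open>r\<close>; then the translation
  part is \<open>j\<close> times that of the \<open>e\<close>-th iterate, so \<open>j\<close> must
  be a multiple of \<open>d div g\<close>.\<close>

lemma kappa_dvd_iff:
  assumes "d > 0" "coprime r d"
  shows "kappa d r t dvd k \<longleftrightarrow> [r ^ k = 1] (mod d) \<and> d dvd t * Sgeom k r"
proof -
  define e where "e = ord d r"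
  define g where "g = gcd d (t * Sgeom e r)"
  have e: "e > 0" using assms by (simp add: e_def coprime_commute)
  have kappa: "kappa d r t = e * (d div g)"
    unfolding kappa_def mord_def e_def[symmetric] g_def[symmetric]
    by (simp add: g_def div_mult_swap mult.commute)
  show ?thesis
  proof (cases "e dvd k")
    case False
    thus ?thesis using ord_divides[of r k d] by (auto simp: kappa e_def[symmetric])
  next
    case True
    then obtain j where k: "k = e * j" by auto
    have "[t * Sgeom k r = t * (j * Sgeom e r)] (mod d)"
      unfolding k by (intro cong_mult cong_refl Sgeom_mult_cong) (simp add: e_def ord del: One_nat_def)
    hence "d dvd t * Sgeom k r \<longleftrightarrow> d dvd t * Sgeom e r * j"
      by (simp add: cong_dvd_iff mult_ac)
    also have "\<dots> \<longleftrightarrow> d div g dvd j"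
      unfolding g_def by (rule dvd_mult_iff_div_gcd_dvd[OF assms(1)])
    also have "\<dots> \<longleftrightarrow> kappa d r t dvd k" using e by (simp add: kappa k)
    finally show ?thesis using True ord_divides[of r k d] by (simp add: e_def)
  qed
qed

lemma kappa_pos:
  assumes "d > 0" "coprime r d"
  shows "kappa d r t > 0"
proof -
  have "gcd d (t * Sgeom (ord d r) r) dvd d * ord d r" by (meson dvd_mult2 gcd_dvd1)
  moreover have "d * ord d r > 0" using assms by (simp add: coprime_commute)
  ultimately show ?thesis
    unfolding kappa_def mord_def by (metis dvd_div_eq_0_iff gr_zeroI neq0_conv)
qed

text \<open>\<open>t\<close> enters \<open>kappa\<close> only through a gcd with \<open>d\<close>,
  and a divisor \<open>d\<close> of \<open>n\<close> cannot tell \<open>t\<close> from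
  \<open>gcd t n\<close>. This later groups translations by their gcd with \<open>n\<close>.\<close>

lemma kappa_gcd:
  assumes "d dvd n"
  shows "kappa d r (gcd t n) = kappa d r t"
proof -
  have "gcd d (gcd t n * s) = gcd d (t * s)" for s
  proof -
    have "gcd d (gcd t n * s) = gcd d (gcd (t * s) (n * s))"
      by (simp add: gcd_mult_distrib_nat mult.commute)
    also have "\<dots> = gcd (gcd d (n * s)) (t * s)" by (simp add: gcd.commute gcd.left_commute)
    also have "gcd d (n * s) = d" using assms by (simp add: gcd_proj1_iff)
    finally show ?thesis .
  qed
  thus ?thesis by (simp add: kappa_def)
qed

text \<open>With \<open>g = gcd A n\<close>, a solvable congruence has as its solutions one residue
  class modulo \<open>n div g\<close>, which has \<open>g\<close> members below
  \<open>n\<close>.\<close>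

lemma card_linear_congruence:
  fixes A B n :: nat
  assumes "n > 0"
  shows "card {x. x < n \<and> n dvd A * x + B} = (if gcd A n dvd B then gcd A n else 0)"
proof (cases "gcd A n dvd B")
  case False
  have "{x. x < n \<and> n dvd A * x + B} = {}"
  proof (rule ccontr)
    assume "{x. x < n \<and> n dvd A * x + B} \<noteq> {}"
    then obtain x where "n dvd A * x + B" by blast
    hence "gcd A n dvd A * x + B" by (meson dvd_trans gcd_dvd2)
    moreover have "gcd A n dvd A * x" by simp
    ultimately show False using False by (simp add: dvd_add_right_iff)
  qed
  thus ?thesis using False by simp
next
  case True
  define g where "g = gcd A n"
  define m where "m = n div g"
  have g: "g > 0" "n = m * g" using assms by (simp_all add: g_def m_def)
  have m: "m > 0" using g assms by simp
  \<comment> \<open>A particular solution needs the right-hand side \<open>- B\<close>, so it is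
    found over the integers and then reduced into the naturals.\<close>
  have "int g dvd - int B" using True by (simp add: g_def)
  hence "\<exists>x. [int A * x = - int B] (mod int n)"
    by (intro cong_solve_dvd_int) (simp add: g_def)
  then obtain z where z: "[int A * z = - int B] (mod int n)" by blast
  define y where "y = nat (z mod int n)"
  have "[int A * int y + int B = int A * z + int B] (mod int n)"
    using assms by (intro cong_add cong_mult cong_refl) (simp add: y_def cong_def)
  also have "[int A * z + int B = - int B + int B] (mod int n)"
    by (intro cong_add z cong_refl)
  finally have "[int (A * y + B) = 0] (mod int n)" by simp
  hence y: "n dvd A * y + B"
    by (metis cong_0_iff int_dvd_int_iff)
  have mem: "n dvd A * x + B \<longleftrightarrow> [x = y] (mod m)" for x
  proof -
    have "n dvd A * x + B \<longleftrightarrow> int n dvd int (A * x + B) - int (A * y + B)"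
      using y by (metis dvd_diff_left_iff int_dvd_int_iff)
    also have "int (A * x + B) - int (A * y + B) = int A * (int x - int y)"
      by (simp add: algebra_simps)
    also have "int n dvd \<dots> \<longleftrightarrow> int m dvd int x - int y"
    proof -
      \<comment> \<open>Cancelling \<open>A\<close> was proved for naturals, so it is applied to the
        absolute difference.\<close>
      have "n dvd A * nat \<bar>int x - int y\<bar> \<longleftrightarrow> m dvd nat \<bar>int x - int y\<bar>"
        using dvd_mult_iff_div_gcd_dvd[OF assms, of A] by (simp add: m_def g_def gcd.commute)
      thus ?thesis by (simp add: nat_abs_mult_distrib flip: dvd_nat_abs_iff)
    qed
    finally show ?thesis by (simp flip: cong_int_iff add: cong_iff_dvd_diff)
  qed
  have "{x. x < n \<and> n dvd A * x + B} = (\<lambda>q. q * m + y mod m) ` {..<g}"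
  proof (intro equalityI subsetI)
    fix x assume "x \<in> {x. x < n \<and> n dvd A * x + B}"
    hence x: "x < n" "x mod m = y mod m" using mem by (auto simp: cong_def)
    have "x = x div m * m + y mod m" using x(2) by (metis div_mult_mod_eq)
    moreover have "x div m < g" using x(1) g m by (simp add: less_mult_imp_div_less mult.commute)
    ultimately show "x \<in> (\<lambda>q. q * m + y mod m) ` {..<g}" by blast
  next
    fix x assume "x \<in> (\<lambda>q. q * m + y mod m) ` {..<g}"
    then obtain q where q: "x = q * m + y mod m" "q < g" by blast
    have "x < Suc q * m" using q(1) m by simp
    also have "\<dots> \<le> g * m" using q(2) by (intro mult_right_mono) auto
    finally show "x \<in> {x. x < n \<and> n dvd A * x + B}" using mem q g by (simp add: cong_def mult.commute)
  qed
  moreover have "inj_on (\<lambda>q. q * m + y mod m) {..<g}" using m by (auto simp: inj_on_def)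
  ultimately show ?thesis using True by (simp add: card_image g_def)
qed

section \<open>Cycle counts in the dihedral group\<close>

lemma dih_aut_simps [simp]:
  "dih_aut n r t (i, True) = ((r * i + t) mod n, True)"
  "dih_aut n r t (i, False) = ((r * i) mod n, False)"
  by (simp_all add: dih_aut_def)

lemma dih_aut_funpow_U: "i < n \<Longrightarrow> (dih_aut n r t ^^ k) (i, False) = ((r ^ k * i) mod n, False)"
  by (induction k) (simp_all add: mod_simps mult_ac)

text \<open>On reflections the map is affine, and its accumulated translations form the geometric
  sum \<open>Sgeom k r\<close>.\<close>

lemma dih_aut_funpow_V:
  assumes "i < n"
  shows "(dih_aut n r t ^^ k) (i, True) = ((r ^ k * i + t * Sgeom k r) mod n, True)"
proof (induction k)
  case 0
  show ?case using assms by (simp add: Sgeom_def)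
next
  case (Suc k)
  have "(r * ((r ^ k * i + t * Sgeom k r) mod n) + t) mod n
      = (r * (r ^ k * i + t * Sgeom k r) + t) mod n"
    unfolding cong_def[symmetric] by (intro cong_add cong_mult cong_refl) (simp add: cong_def)
  also have "r * (r ^ k * i + t * Sgeom k r) + t = r ^ Suc k * i + t * Sgeom (Suc k) r"
    by (simp add: Sgeom_Suc algebra_simps)
  finally show ?case using Suc by simp
qed

section \<open>Fixed points of the iterates\<close>

lemma affine_fixpoint_iff:
  assumes "(i :: nat) < n" "a \<ge> 1"
  shows "(a * i + b) mod n = i \<longleftrightarrow> n dvd (a - 1) * i + b"
proof -
  \<comment> \<open>Splitting off one copy of \<open>i\<close> keeps everything in the naturals,
    where \<open>a - 1\<close> is exact because \<open>a\<close> is positive.\<close>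
  have "a * i + b = ((a - 1) * i + b) + i" using assms(2)
    by (cases a) auto
  moreover have "(x + i) mod n = i \<longleftrightarrow> n dvd x" for x
  proof -
    have "(x + i) mod n = i \<longleftrightarrow> [x + i = i] (mod n)" using assms(1) by (simp add: cong_def)
    thus ?thesis by (simp add: cong_add_rcancel_0_nat cong_0_iff)
  qed
  ultimately show ?thesis by presburger
qed

lemma dih_aut_funpow_U_fixed_iff:
  assumes "i < n" "r \<ge> 1"
  shows "(dih_aut n r t ^^ k) (i, False) = (i, False) \<longleftrightarrow> n dvd (r ^ k - 1) * i"
  using affine_fixpoint_iff[OF assms(1), of "r ^ k" 0] assms by (simp add: dih_aut_funpow_U)

lemma dih_aut_funpow_V_fixed_iff:
  assumes "i < n" "r \<ge> 1"
  shows "(dih_aut n r t ^^ k) (i, True) = (i, True) \<longleftrightarrow> n dvd (r ^ k - 1) * i + t * Sgeom k r"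
  using affine_fixpoint_iff[OF assms(1), of "r ^ k"] assms by (simp add: dih_aut_funpow_V)

lemma power_cong_1_iff: "(r :: nat) \<ge> 1 \<Longrightarrow> [r ^ k = 1] (mod m) \<longleftrightarrow> m dvd r ^ k - 1"
  by (simp add: cong_altdef_nat)

text \<open>Fixed reflections solve a linear congruence with coefficient \<open>r ^ k - 1\<close>,
  hence number \<open>d k\<close> or none. Solvability is the translation half of
  \<open>kappa_dvd_iff\<close> at modulus \<open>d k\<close>; the power half holds by the choice of
  \<open>d k\<close>.\<close>

lemma card_fixpoints_V:
  assumes "n > 0" "r \<ge> 1" "coprime r n"
  defines "d \<equiv> \<lambda>k. gcd (r ^ k - 1) n"
  shows "card {x \<in> dih_V n. (dih_aut n r t ^^ k) x = x} = (if kappa (d k) r t dvd k then d k else 0)"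
proof -
  have "{x \<in> dih_V n. (dih_aut n r t ^^ k) x = x}
      = (\<lambda>i. (i, True)) ` {i. i < n \<and> n dvd (r ^ k - 1) * i + t * Sgeom k r}"
    using dih_aut_funpow_V_fixed_iff[OF _ assms(2)] by (auto simp: dih_V_def)
  hence "card {x \<in> dih_V n. (dih_aut n r t ^^ k) x = x}
      = card {i. i < n \<and> n dvd (r ^ k - 1) * i + t * Sgeom k r}"
    by (simp add: card_image inj_on_def)
  also have "\<dots> = (if d k dvd t * Sgeom k r then d k else 0)"
    unfolding d_def by (rule card_linear_congruence[OF assms(1)])
  also have "d k dvd t * Sgeom k r \<longleftrightarrow> kappa (d k) r t dvd k"
  proof -
    have "d k > 0" "d k dvd n" using assms by (simp_all add: d_def)
    moreover from this have "coprime r (d k)" using assms(3) by (meson coprime_divisors dvd_refl)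
    moreover have "[r ^ k = 1] (mod d k)" using assms(2) by (simp add: power_cong_1_iff d_def del: One_nat_def)
    ultimately show ?thesis by (simp add: kappa_dvd_iff)
  qed
  finally show ?thesis .
qed

section \<open>The maps \<open>dih_aut\<close> as permutations of the rotations and of the
  reflections\<close>

lemma dih_aut_inj:
  assumes "coprime r n"
  shows "inj_on (dih_aut n r t) ({0..<n} \<times> UNIV)"
proof (rule inj_onI, clarify)
  fix i j :: nat and b c
  assume ij: "i \<in> {0..<n}" "j \<in> {0..<n}" and eq: "dih_aut n r t (i, b) = dih_aut n r t (j, c)"
  have bc: "b = c" using eq by (cases b; cases c) auto
  have "[r * i = r * j] (mod n)"
  proof (cases b)
    case True
    hence "[r * i + t = r * j + t] (mod n)" using eq bc by (simp add: cong_def)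
    thus ?thesis by (simp add: cong_add_rcancel_nat)
  qed (use eq bc in \<open>simp add: cong_def\<close>)
  hence "[i = j] (mod n)" using assms by (simp add: cong_mult_lcancel_nat)
  thus "i = j \<and> b = c" using ij bc by (simp add: cong_def)
qed

lemma finite_dih_U: "finite (dih_U n)" and finite_dih_V: "finite (dih_V n)"
proof -
  have "dih_U n \<subseteq> {0..<n} \<times> UNIV" "dih_V n \<subseteq> {0..<n} \<times> UNIV"
    by (auto simp: dih_U_def dih_V_def)
  thus "finite (dih_U n)" "finite (dih_V n)" by (auto intro: finite_subset)
qed

lemma bij_betw_dih_aut:
  assumes "coprime r n" "X \<subseteq> {0..<n} \<times> UNIV" "dih_aut n r t ` X \<subseteq> X"
  shows "bij_betw (dih_aut n r t) X X"
  using assms finite_subset[OF assms(2)] inj_on_subset[OF dih_aut_inj[OF assms(1)] assms(2)]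
  by (simp add: bij_betw_def endo_inj_surj)

lemma bij_betw_dih_aut_V:
  assumes "n > 0" "coprime r n"
  shows "bij_betw (dih_aut n r t) (dih_V n) (dih_V n)"
  using assms by (intro bij_betw_dih_aut) (auto simp: dih_V_def)

lemma bij_betw_dih_aut_U:
  assumes "n > 0" "coprime r n"
  shows "bij_betw (dih_aut n r t) (dih_U n) (dih_U n)"
proof (intro bij_betw_dih_aut assms)
  \<comment> \<open>The identity is left out of \<open>dih_U\<close>, so no other rotation may be
    sent to it.\<close>
  have "r * i mod n > 0" if "0 < i" "i < n" for i
  proof (rule ccontr)
    assume "\<not> r * i mod n > 0"
    hence "n dvd i" using assms(2) by (metis coprime_commute coprime_dvd_mult_right_iff gr0I mod_0_imp_dvd)
    thus False using that by (auto dest: dvd_imp_le)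
  qed
  thus "dih_aut n r t ` dih_U n \<subseteq> dih_U n" using assms by (auto simp: dih_U_def)
qed (auto simp: dih_U_def)

text \<open>The rotation with exponent \<open>i\<close> has period the order of \<open>r\<close>
  modulo \<open>n div gcd n i\<close>. Grouping the inverse periods by this modulus \<open>d\<close>
  gives the sum, since \<open>totient d\<close> exponents share it.\<close>

lemma num_cycles_U:
  assumes "n > 1" "coprime r n"
  shows "real (num_cycles (dih_U n) (dih_aut n r t)) =
    (\<Sum>d\<in>{d. d > 1 \<and> d dvd n}. real (totient d) / real (mord d r))"
proof -
  have r: "r \<ge> 1" using assms by (cases r) auto
  have "real (num_cycles (dih_U n) (dih_aut n r t))
      = (\<Sum>x\<in>dih_U n. 1 / real (ord (n div gcd n (fst x)) r))"
  proof (rule num_cycles_eq_sum_inverse_period)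
    show "bij_betw (dih_aut n r t) (dih_U n) (dih_U n)" using assms by (simp add: bij_betw_dih_aut_U)
    fix x assume "x \<in> dih_U n"
    then obtain i where x: "x = (i, False)" "0 < i" "i < n" by (auto simp: dih_U_def)
    have "n div gcd n (fst x) dvd n" by (metis dvd_div_mult_self dvd_triv_left gcd_dvd1)
    hence "coprime (n div gcd n (fst x)) r"
      using assms(2) by (metis coprime_commute coprime_divisors dvd_refl)
    thus "ord (n div gcd n (fst x)) r > 0" by simp
    fix k
    have "(dih_aut n r t ^^ k) x = x \<longleftrightarrow> n dvd i * (r ^ k - 1)"
      using dih_aut_funpow_U_fixed_iff[OF x(3) r] x by (simp add: mult.commute)
    also have "\<dots> \<longleftrightarrow> n div gcd n i dvd r ^ k - 1"
      using assms by (intro dvd_mult_iff_div_gcd_dvd) simp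
    also have "\<dots> \<longleftrightarrow> [r ^ k = 1] (mod n div gcd n i)" using r by (simp add: power_cong_1_iff del: One_nat_def)
    finally show "(dih_aut n r t ^^ k) x = x \<longleftrightarrow> ord (n div gcd n (fst x)) r dvd k"
      using x by (simp add: ord_divides del: One_nat_def)
  qed (rule finite_dih_U)
  also have "\<dots> = (\<Sum>i\<in>{0<..<n}. 1 / real (ord (n div gcd n i) r))"
    by (rule sum.reindex_bij_witness[of _ "\<lambda>i. (i, False)" fst]) (auto simp: dih_U_def)
  also have "\<dots> = (\<Sum>d\<in>{d. d > 1 \<and> d dvd n}.
      real (card {i \<in> {0<..<n}. n div gcd n i = d}) * (1 / real (ord d r)))"
  proof (rule sum_fun_comp)
    have "n div gcd n i > 1 \<and> n div gcd n i dvd n" if i: "i \<in> {0<..<n}" for i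
    proof
      show "n div gcd n i dvd n" by (metis dvd_div_mult_self dvd_triv_left gcd_dvd1)
      have "gcd n i \<le> i" using i by (intro gcd_le2_nat) auto
      hence "gcd n i < n" using i by (meson greaterThanLessThan_iff order_le_less_trans)
      moreover have "n = gcd n i * (n div gcd n i)" by simp
      ultimately show "n div gcd n i > 1"
        by (metis assms(1) less_one linorder_neqE_nat mult.right_neutral mult_0_right nat_neq_iff not_less_zero)
    qed
    thus "(\<lambda>i. n div gcd n i) ` {0<..<n} \<subseteq> {d. d > 1 \<and> d dvd n}" by blast
    show "finite {d. d > 1 \<and> d dvd n}"
      using assms by (intro finite_subset[OF _ finite_divisors_nat[of n]]) auto
  qed simp
  also have "\<dots> = (\<Sum>d\<in>{d. d > 1 \<and> d dvd n}. real (totient d) / real (mord d r))"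
  proof (rule sum.cong)
    fix d assume "d \<in> {d. d > 1 \<and> d dvd n}"
    hence d: "d > 1" "d dvd n" by auto
    have "n div gcd n i = d \<longleftrightarrow> gcd i n = n div d" for i
      using d assms by (metis dvd_div_mult_self gcd.commute gcd_dvd2 nonzero_mult_div_cancel_left
          nonzero_mult_div_cancel_right not_gr_zero mult_eq_0_iff not_one_less_zero)
    \<comment> \<open>The totient count ranges up to and including \<open>n\<close>, the sum stops
      before it. The extra index \<open>n\<close> belongs to \<open>d = 1\<close>, which is
      excluded.\<close>
    moreover have "gcd n n \<noteq> n div d" using d assms by auto
    ultimately have "{i \<in> {0<..<n}. n div gcd n i = d} = {i \<in> {0<..n}. gcd i n = n div d}"
      by (auto simp: order_le_less)
    hence "card {i \<in> {0<..<n}. n div gcd n i = d} = totient (n div (n div d))"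
      using card_gcd_eq_totient[of n "n div d"] d assms by (simp add: div_dvd_iff_mult)
    also have "n div (n div d) = d"
    proof -
      obtain k where k: "n = d * k" using d(2) by auto
      hence "k > 0" using assms(1) by (cases k) auto
      thus ?thesis using k d(1) by simp
    qed
    finally show "real (card {i \<in> {0<..<n}. n div gcd n i = d}) * (1 / real (ord d r))
        = real (totient d) / real (mord d r)" by (simp add: mord_def)
  qed simp
  finally show ?thesis .
qed

text \<open>Both gcds have the same divisors \<open>e\<close>: such an \<open>e\<close> divides
  \<open>r ^ m - 1\<close> iff \<open>ord e r\<close> divides \<open>m\<close>, and
  \<open>ord e r\<close> divides \<open>c * M\<close>, so dividing \<open>c * j\<close> amounts to
  dividing \<open>c * gcd j M\<close>.\<close>

lemma gcd_power_minus_one_gcd: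
  fixes r n c j M :: nat
  assumes "r \<ge> 1" "ord n r dvd c * M"
  shows "gcd (r ^ (c * gcd j M) - 1) n = gcd (r ^ (c * j) - 1) n"
proof -
  have iff: "e dvd r ^ (c * gcd j M) - 1 \<longleftrightarrow> e dvd r ^ (c * j) - 1" if "e dvd n" for e
  proof -
    have "[r ^ (c * M) = 1] (mod n)" using assms(2) by (simp add: ord_divides del: One_nat_def)
    hence "[r ^ (c * M) = 1] (mod e)" using that by (rule cong_dvd_modulus_nat)
    hence "ord e r dvd c * M" by (simp add: ord_divides del: One_nat_def)
    hence "ord e r dvd c * gcd j M \<longleftrightarrow> ord e r dvd c * j"
      by (auto simp: gcd_mult_distrib_nat)
    thus ?thesis
      using assms(1) by (simp add: ord_divides flip: power_cong_1_iff del: One_nat_def)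
  qed
  show ?thesis by (rule gcd_unique_nat[THEN iffD1]) (use iff in auto)
qed

text \<open>That the lcm divides \<open>kappa n r t\<close> is general. Conversely, the exponent
  \<open>k\<close> shows that \<open>d\<close> really occurs: its power of the map fixes
  \<open>d > 0\<close> reflections, and so does the power at the lcm, a multiple of
  \<open>k\<close>.\<close>

lemma kappa_eq_lcm:
  assumes "n > 0" "r \<ge> 1" "coprime r n" "d dvd n"
    and fixed: "kappa d r t dvd k" "k dvd lcm (kappa d r t) (ord n r)" "gcd (r ^ k - 1) n = d"
  shows "kappa n r t = lcm (kappa d r t) (ord n r)"
proof (rule dvd_antisym)
  have d: "d > 0" "coprime r d"
    using assms(1,4) dvd_pos_nat coprime_divisors[OF dvd_refl assms(4,3)] by blast+
  have "kappa n r t dvd kappa n r t" by simp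
  hence n: "[r ^ kappa n r t = 1] (mod n)" "n dvd t * Sgeom (kappa n r t) r"
    using kappa_dvd_iff[OF assms(1,3)] by blast+
  have "kappa d r t dvd kappa n r t"
    using n assms(4) kappa_dvd_iff[OF d] cong_dvd_modulus_nat dvd_trans by blast
  moreover have "ord n r dvd kappa n r t" using n(1) by (simp add: ord_divides del: One_nat_def)
  ultimately show "lcm (kappa d r t) (ord n r) dvd kappa n r t" by (rule lcm_least)
  have "card {x \<in> dih_V n. (dih_aut n r t ^^ k) x = x} = d"
    using card_fixpoints_V[OF assms(1-3), of k t] fixed by simp
  hence "{x \<in> dih_V n. (dih_aut n r t ^^ k) x = x} \<noteq> {}" using d by (metis card.empty less_irrefl)
  then obtain i where i: "i < n" "(dih_aut n r t ^^ k) (i, True) = (i, True)"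
    by (auto simp: dih_V_def)
  \<comment> \<open>The \<open>L\<close>-th power of the map is a translation fixing \<open>i\<close>, hence trivial.\<close>
  define L where "L = lcm (kappa d r t) (ord n r)"
  obtain q where q: "L = k * q" using fixed(2) by (auto simp: L_def)
  have "(dih_aut n r t ^^ L) (i, True) = (i, True)" using funpow_multiple[OF i(2)] q by simp
  hence "n dvd (r ^ L - 1) * i + t * Sgeom L r"
    using dih_aut_funpow_V_fixed_iff[OF i(1) assms(2)] by blast
  moreover have L: "[r ^ L = 1] (mod n)" by (simp add: ord_divides L_def del: One_nat_def)
  hence "n dvd (r ^ L - 1) * i" using assms(2) by (simp add: power_cong_1_iff del: One_nat_def)
  ultimately have "n dvd t * Sgeom L r" by (simp add: dvd_add_right_iff)
  thus "kappa n r t dvd lcm (kappa d r t) (ord n r)"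
    using L kappa_dvd_iff[OF assms(1,3)] by (simp add: L_def)
qed

text \<open>Write \<open>k = c * j\<close> with \<open>j\<close> from 1 to \<open>M\<close>. The gcd
  depends on \<open>j\<close> only through \<open>l = gcd j M\<close>, and each \<open>l\<close>
  arises from \<open>totient (M div l)\<close> values of \<open>j\<close>.\<close>

lemma card_exponents_with_gcd:
  fixes n r d t :: nat
  assumes "n > 0" "r \<ge> 1" "coprime r n" "d dvd n"
  defines "c \<equiv> kappa d r t" and "M \<equiv> ord n r div gcd (kappa d r t) (ord n r)"
  shows "card {k \<in> {1..kappa n r t}. gcd (r ^ k - 1) n = d \<and> c dvd k} =
    (\<Sum>l\<in>{l. l > 0 \<and> l dvd M \<and> gcd (r ^ (l * c) - 1) n = d}. totient (M div l))"
    (is "card ?K = sum _ ?L")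
proof -
  have d: "d > 0" "coprime r d"
    using assms(1,4) dvd_pos_nat coprime_divisors[OF dvd_refl assms(4,3)] by blast+
  have c: "c > 0" unfolding c_def by (rule kappa_pos[OF d])
  have o: "ord n r > 0" using assms(3) by (simp add: coprime_commute)
  have cM: "c * M = lcm c (ord n r)" by (simp add: c_def M_def lcm_nat_def div_mult_swap)
  have M: "M > 0" using cM c o by (metis lcm_pos_nat nat_0_less_mult_iff)
  have finL: "finite ?L" by (rule finite_subset[OF _ finite_divisors_nat[OF M]]) auto
  have G: "gcd (r ^ (c * gcd j M) - 1) n = gcd (r ^ (c * j) - 1) n" for j
    by (rule gcd_power_minus_one_gcd[OF assms(2)]) (simp add: cM)
  have L: "gcd j M \<in> ?L" if "gcd (r ^ (c * j) - 1) n = d" for j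
    using that G[of j] M by (simp add: mult.commute)
  show ?thesis
  \<comment> \<open>Only a contributing \<open>d\<close> makes \<open>c * M\<close> the full period.
    Otherwise no exponent qualifies and both sides vanish.\<close>
  proof (cases "?L = {}")
    case True
    have "?K = {}"
    proof (rule ccontr)
      assume "?K \<noteq> {}"
      then obtain k where k: "gcd (r ^ k - 1) n = d" "c dvd k" by blast
      then obtain j where "k = c * j" by auto
      thus False using L[of j] k(1) True by blast
    qed
    thus ?thesis using True by (metis card.empty sum.empty)
  next
    case False
    then obtain l where l: "l dvd M" "gcd (r ^ (l * c) - 1) n = d" by blast
    have "kappa n r t = lcm (kappa d r t) (ord n r)"
    proof (rule kappa_eq_lcm[OF assms(1-4)])
      show "kappa d r t dvd l * c" by (simp add: c_def)
      have "l * c dvd c * M" using l(1) by (simp add: mult.commute)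
      thus "l * c dvd lcm (kappa d r t) (ord n r)" unfolding c_def[symmetric] cM[symmetric] .
    qed (rule l(2))
    hence N: "kappa n r t = c * M" by (simp add: cM c_def[symmetric])
    have "?K = (\<lambda>j. c * j) ` {j \<in> {0<..M}. gcd (r ^ (c * j) - 1) n = d}"
      using c unfolding N by (auto elim!: dvdE)
    hence "card ?K = card {j \<in> {0<..M}. gcd (r ^ (c * j) - 1) n = d}"
      using c by (simp add: card_image inj_on_def)
    also have "{j \<in> {0<..M}. gcd (r ^ (c * j) - 1) n = d} = (\<Union>l\<in>?L. {j \<in> {0<..M}. gcd j M = l})"
      using L G by (auto simp: mult.commute)
    also have "card \<dots> = (\<Sum>l\<in>?L. card {j \<in> {0<..M}. gcd j M = l})"
      by (rule card_UN_disjoint[OF finL]) auto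
    also have "\<dots> = (\<Sum>l\<in>?L. totient (M div l))"
      using M by (intro sum.cong refl card_gcd_eq_totient) auto
    finally show ?thesis .
  qed
qed

text \<open>Averages the fixed-point counts over one full period and sorts the exponents
  \<open>k\<close> by \<open>d = gcd (r ^ k - 1) n\<close>.\<close>

lemma num_cycles_V:
  assumes "n > 1" "coprime r n"
  shows "real (num_cycles (dih_V n) (dih_aut n r t)) =
    (\<Sum>(d, l)\<in>{(d, l). d > 0 \<and> l > 0 \<and> d dvd n
           \<and> l dvd (mord n r div gcd (kappa d r t) (mord n r))
           \<and> gcd (r ^ (l * kappa d r t) - 1) n = d}.
       real d / real (kappa n r t) *
       real (totient (mord n r div (l * gcd (kappa d r t) (mord n r)))))"
proof -
  have n: "n > 0" using assms by simp
  have r: "r \<ge> 1" using assms by (cases r) auto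
  define N where "N = kappa n r t"
  define D where "D = {d. d dvd n}"
  define M where "M d = ord n r div gcd (kappa d r t) (ord n r)" for d
  define L where "L d = {l. l > 0 \<and> l dvd M d \<and> gcd (r ^ (l * kappa d r t) - 1) n = d}" for d
  have N: "N > 0" unfolding N_def by (rule kappa_pos[OF n assms(2)])
  have finD: "finite D" using n by (simp add: D_def)
  have finL: "finite (L d)" for d
  proof -
    have "M d > 0" using assms(2) by (simp add: M_def coprime_commute div_greater_zero_iff gcd_le2_nat)
    from finite_subset[OF _ finite_divisors_nat[OF this]] show ?thesis by (auto simp: L_def)
  qed
  \<comment> \<open>\<open>kappa_dvd_iff\<close> at modulus \<open>n\<close> says that the
    \<open>N\<close>-th iterate is the identity on reflections.\<close>
  have "kappa n r t dvd N" by (simp add: N_def)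
  hence "[r ^ N = 1] (mod n)" "n dvd t * Sgeom N r" using kappa_dvd_iff[OF n assms(2)] by blast+
  hence period: "(dih_aut n r t ^^ N) x = x" if "x \<in> dih_V n" for x
    using that dih_aut_funpow_V_fixed_iff[OF _ r, of _ n N t] r
    by (auto simp: dih_V_def power_cong_1_iff simp del: One_nat_def)
  \<comment> \<open>Spreading the count over all divisors \<open>d\<close>, at most one of which
    contributes, allows the sums over \<open>k\<close> and \<open>d\<close> to be exchanged.\<close>
  have fix_sum: "card {x \<in> dih_V n. (dih_aut n r t ^^ k) x = x} =
      (\<Sum>d\<in>D. if gcd (r ^ k - 1) n = d \<and> kappa d r t dvd k then d else 0)" for k
  proof -
    have "(\<Sum>d\<in>D. if gcd (r ^ k - 1) n = d \<and> kappa d r t dvd k then d else 0)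
        = (\<Sum>d\<in>D. if gcd (r ^ k - 1) n = d then (if kappa d r t dvd k then d else 0) else 0)"
      by (intro sum.cong) auto
    also have "\<dots> = (if kappa (gcd (r ^ k - 1) n) r t dvd k then gcd (r ^ k - 1) n else 0)"
      using finD by (simp add: sum.delta' D_def)
    finally show ?thesis using card_fixpoints_V[OF n r assms(2)] by simp
  qed
  have "(\<Sum>k=1..N. card {x \<in> dih_V n. (dih_aut n r t ^^ k) x = x})
      = (\<Sum>d\<in>D. \<Sum>k=1..N. if gcd (r ^ k - 1) n = d \<and> kappa d r t dvd k then d else 0)"
    unfolding fix_sum by (rule sum.swap)
  also have "\<dots> = (\<Sum>d\<in>D. d * card {k \<in> {1..N}. gcd (r ^ k - 1) n = d \<and> kappa d r t dvd k})"
    by (intro sum.cong refl) (simp add: sum.If_cases Int_def mult.commute)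
  also have "\<dots> = (\<Sum>d\<in>D. d * (\<Sum>l\<in>L d. totient (M d div l)))"
    unfolding N_def L_def M_def using card_exponents_with_gcd[OF n r assms(2)]
    by (intro sum.cong refl) (simp add: D_def)
  also have "\<dots> = (\<Sum>(d, l)\<in>Sigma D L. d * totient (M d div l))"
    using finD finL by (simp add: sum_distrib_left sum.Sigma)
  finally have total: "(\<Sum>k=1..N. card {x \<in> dih_V n. (dih_aut n r t ^^ k) x = x})
      = (\<Sum>(d, l)\<in>Sigma D L. d * totient (M d div l))" .
  have "real (num_cycles (dih_V n) (dih_aut n r t))
      = (\<Sum>k=1..N. real (card {x \<in> dih_V n. (dih_aut n r t ^^ k) x = x})) / real N"
    using period by (intro num_cycles_eq_average_fixpoints finite_dih_V bij_betw_dih_aut_V n assms N)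
  also have "\<dots> = real (\<Sum>(d, l)\<in>Sigma D L. d * totient (M d div l)) / real N"
    unfolding total[symmetric] by simp
  also have "\<dots> = (\<Sum>(d, l)\<in>Sigma D L. real d / real N * real (totient (M d div l)))"
    by (simp add: sum_divide_distrib case_prod_unfold)
  also have "Sigma D L = {(d, l). d > 0 \<and> l > 0 \<and> d dvd n
           \<and> l dvd (mord n r div gcd (kappa d r t) (mord n r))
           \<and> gcd (r ^ (l * kappa d r t) - 1) n = d}"
    using n by (auto simp: D_def L_def M_def mord_def dvd_pos_nat)
  finally show ?thesis
    by (simp add: M_def N_def mord_def mult.commute flip: div_mult2_eq)
qed

lemma num_cycles_V_gcd:
  assumes "n > 1" "coprime r n"
  shows "num_cycles (dih_V n) (dih_aut n r (gcd t n)) = num_cycles (dih_V n) (dih_aut n r t)"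
proof -
  have "real (num_cycles (dih_V n) (dih_aut n r (gcd t n))) = num_cycles (dih_V n) (dih_aut n r t)"
    unfolding num_cycles_V[OF assms]
    by (rule sum.cong) (auto simp: kappa_gcd)
  thus ?thesis by simp
qed

section \<open>Automorphisms of the dihedral group\<close>

lemma dihedral_simps [simp]:
  "carrier (dihedral n) = {0..<n} \<times> UNIV" "\<one>\<^bsub>dihedral n\<^esub> = (0, False)"
  "(i, False) \<otimes>\<^bsub>dihedral n\<^esub> (j, c) = ((i + j) mod n, c)"
  "(i, True) \<otimes>\<^bsub>dihedral n\<^esub> (j, c) = ((i + (n - j mod n)) mod n, \<not> c)"
  by (simp_all add: dihedral_def)

text \<open>Over the integers the exponents add or subtract without the detour through
  \<open>n - j mod n\<close>, so the group and homomorphism laws become ring identities modulo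
  \<open>n\<close>.\<close>

lemma int_fst_dihedral_mult:
  assumes "n > 0"
  shows "int (fst (x \<otimes>\<^bsub>dihedral n\<^esub> y))
    = (if snd x then int (fst x) - int (fst y) else int (fst x) + int (fst y)) mod int n"
proof -
  obtain i b j c where xy: "x = (i, b)" "y = (j, c)" by (metis surj_pair)
  have "int (n - j mod n) = int n - int j mod int n"
    using assms by (subst of_nat_diff) (simp_all add: of_nat_mod less_imp_le)
  hence "int ((i + (n - j mod n)) mod n) = (int i + int n - int j mod int n) mod int n"
    by (simp only: of_nat_mod of_nat_add add_diff_eq)
  also have "\<dots> = (int i - int j + int n) mod int n"
    by (simp only: mod_diff_right_eq) (simp add: algebra_simps)
  also have "\<dots> = (int i - int j) mod int n" by simp
  finally show ?thesis using xy by (cases b) (simp_all add: of_nat_mod)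
qed

lemma snd_dihedral_mult [simp]: "snd (x \<otimes>\<^bsub>dihedral n\<^esub> y) \<longleftrightarrow> snd x \<noteq> snd y"
  by (cases x; cases y; cases "snd x") auto

lemma group_dihedral:
  assumes "n > 0"
  shows "group (dihedral n)"
proof (rule groupI)
  fix x y assume "x \<in> carrier (dihedral n)" "y \<in> carrier (dihedral n)"
  thus "x \<otimes>\<^bsub>dihedral n\<^esub> y \<in> carrier (dihedral n)"
    using assms by (cases x; cases y; cases "snd x") auto
next
  fix x y z
  show "x \<otimes>\<^bsub>dihedral n\<^esub> y \<otimes>\<^bsub>dihedral n\<^esub> z = x \<otimes>\<^bsub>dihedral n\<^esub> (y \<otimes>\<^bsub>dihedral n\<^esub> z)"
  proof (rule prod_eqI)
    have "int (fst (x \<otimes>\<^bsub>dihedral n\<^esub> y \<otimes>\<^bsub>dihedral n\<^esub> z)) = int (fst (x \<otimes>\<^bsub>dihedral n\<^esub> (y \<otimes>\<^bsub>dihedral n\<^esub> z)))"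
      using assms by (cases "snd x"; cases "snd y") (simp_all add: int_fst_dihedral_mult mod_simps algebra_simps)
    thus "fst (x \<otimes>\<^bsub>dihedral n\<^esub> y \<otimes>\<^bsub>dihedral n\<^esub> z) = fst (x \<otimes>\<^bsub>dihedral n\<^esub> (y \<otimes>\<^bsub>dihedral n\<^esub> z))"
      by (simp only: of_nat_eq_iff)
  qed auto
next
  fix x assume x: "x \<in> carrier (dihedral n)"
  thus "\<one>\<^bsub>dihedral n\<^esub> \<otimes>\<^bsub>dihedral n\<^esub> x = x" by (cases x) auto
  obtain i b where ib: "x = (i, b)" "i < n" using x by auto
  show "\<exists>y\<in>carrier (dihedral n). y \<otimes>\<^bsub>dihedral n\<^esub> x = \<one>\<^bsub>dihedral n\<^esub>"
  \<comment> \<open>Reflections are their own inverses; for rotations the outer \<open>mod n\<close>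
    takes care of exponent 0.\<close>
  proof (cases b)
    case True
    thus ?thesis using ib by (intro bexI[of _ "(i, True)"]) auto
  next
    case False
    thus ?thesis using ib by (intro bexI[of _ "((n - i) mod n, False)"]) (auto simp: mod_simps)
  qed
qed (use assms in auto)

section \<open>The affine maps form the whole automorphism group\<close>

lemma int_fst_dih_aut:
  "int (fst (dih_aut n r t x)) = (int r * int (fst x) + (if snd x then int t else 0)) mod int n"
  by (cases x; cases "snd x") (auto simp: of_nat_mod)

lemma snd_dih_aut [simp]: "snd (dih_aut n r t x) = snd x"
  by (cases x; cases "snd x") auto

lemma mod_mult_mod_add:
  fixes a b c d :: int
  shows "(a * (b mod c) + d) mod c = (a * b + d) mod c"
  by (metis mod_add_left_eq mod_mult_right_eq)

lemma dih_aut_in_hom: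
  assumes "n > 0"
  shows "dih_aut n r t \<in> hom (dihedral n) (dihedral n)"
proof (rule homI)
  fix x y
  show "dih_aut n r t (x \<otimes>\<^bsub>dihedral n\<^esub> y) = dih_aut n r t x \<otimes>\<^bsub>dihedral n\<^esub> dih_aut n r t y"
  proof (rule prod_eqI)
    have "int (fst (dih_aut n r t (x \<otimes>\<^bsub>dihedral n\<^esub> y)))
        = int (fst (dih_aut n r t x \<otimes>\<^bsub>dihedral n\<^esub> dih_aut n r t y))"
      using assms by (cases "snd x"; cases "snd y")
        (simp_all add: int_fst_dih_aut int_fst_dihedral_mult mod_simps mod_mult_mod_add,
          simp_all add: algebra_simps)
    thus "fst (dih_aut n r t (x \<otimes>\<^bsub>dihedral n\<^esub> y)) = fst (dih_aut n r t x \<otimes>\<^bsub>dihedral n\<^esub> dih_aut n r t y)"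
      by (simp only: of_nat_eq_iff)
  qed simp
next
  fix x assume "x \<in> carrier (dihedral n)"
  thus "dih_aut n r t x \<in> carrier (dihedral n)"
    using assms by (cases x; cases "snd x") auto
qed

lemma restrict_dih_aut_in_auto:
  assumes "n > 0" "coprime r n"
  shows "restrict (dih_aut n r t) (carrier (dihedral n)) \<in> auto (dihedral n)"
proof -
  interpret group "dihedral n" by (rule group_dihedral[OF assms(1)])
  note hom = dih_aut_in_hom[OF assms(1), of r t]
  have "bij_betw (dih_aut n r t) (carrier (dihedral n)) (carrier (dihedral n))"
  proof (rule bij_betw_dih_aut[OF assms(2)])
    show "dih_aut n r t ` carrier (dihedral n) \<subseteq> carrier (dihedral n)"
      using hom_in_carrier[OF hom] by blast
  qed simp
  moreover have "restrict (dih_aut n r t) (carrier (dihedral n)) \<in> hom (dihedral n) (dihedral n)"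
    using hom m_closed by (auto simp: hom_def simp del: dihedral_simps)
  ultimately show ?thesis by (simp add: auto_def Bij_def)
qed

text \<open>An automorphism is determined by the images of the two generators. The generating
  rotation must go to a rotation with exponent \<open>r\<close> and the reflection
  \<open>(0, True)\<close> to a reflection with exponent \<open>t\<close>.\<close>

lemma auto_dihedral_cases:
  assumes "n > 2" "\<sigma> \<in> auto (dihedral n)"
  obtains r t where "1 \<le> r" "r \<le> n - 1" "coprime r n" "t \<in> {0<..n}"
    "\<sigma> = restrict (dih_aut n r t) (carrier (dihedral n))"
proof -
  let ?C = "carrier (dihedral n)"
  interpret group "dihedral n" using assms by (intro group_dihedral) simp
  have hom: "\<sigma> \<in> hom (dihedral n) (dihedral n)" and ext: "\<sigma> \<in> extensional ?C"
    and inj: "inj_on \<sigma> ?C" and surj: "\<sigma> ` ?C = ?C"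
    using assms(2) by (auto simp: auto_def Bij_def bij_betw_def)
  have mult: "\<sigma> (x \<otimes>\<^bsub>dihedral n\<^esub> y) = \<sigma> x \<otimes>\<^bsub>dihedral n\<^esub> \<sigma> y" if "x \<in> ?C" "y \<in> ?C" for x y
    using hom_mult[OF hom that] .
  have one: "\<sigma> (0, False) = (0, False)"
    using hom_one[OF hom group_axioms group_axioms] by simp
  obtain r b where r: "\<sigma> (1, False) = (r, b)" "r < n"
    using hom_in_carrier[OF hom, of "(1, False)"] assms(1) by auto
  \<comment> \<open>Reflections square to the identity, whereas the square of the generating
    rotation is nontrivial because \<open>n > 2\<close>.\<close>
  have "\<not> b"
  proof
    assume b
    have "(1, False) \<otimes>\<^bsub>dihedral n\<^esub> (1, False) = (2, False)" using assms(1) by simp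
    hence "\<sigma> (2, False) = \<sigma> (1, False) \<otimes>\<^bsub>dihedral n\<^esub> \<sigma> (1, False)"
      using mult[of "(1, False)" "(1, False)"] assms(1) by (simp add: numeral_2_eq_2)
    also have "\<dots> = (0, False)" using r \<open>b\<close> by simp
    finally have "\<sigma> (2, False) = \<sigma> (0, False)" using one by simp
    hence "(2, False) = (0 :: nat, False)" using inj assms(1) by (auto dest: inj_onD)
    thus False by simp
  qed
  have rot: "\<sigma> (i, False) = ((r * i) mod n, False)" if "i < n" for i
    using that
  proof (induction i)
    case (Suc i)
    have "\<sigma> (Suc i, False) = \<sigma> ((1, False) \<otimes>\<^bsub>dihedral n\<^esub> (i, False))" using Suc by simp
    also have "\<dots> = \<sigma> (1, False) \<otimes>\<^bsub>dihedral n\<^esub> \<sigma> (i, False)" using Suc by (intro mult) auto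
    finally show ?case using Suc r \<open>\<not> b\<close> by (simp add: mod_simps)
  qed (simp add: one)
  obtain t c where t: "\<sigma> (0, True) = (t, c)" "t < n"
    using hom_in_carrier[OF hom, of "(0, True)"] assms(1) by auto
  have refl: "\<sigma> (i, True) = ((r * i + t) mod n, c)" if "i < n" for i
  proof -
    have "\<sigma> (i, True) = \<sigma> ((i, False) \<otimes>\<^bsub>dihedral n\<^esub> (0, True))" using that by simp
    also have "\<dots> = \<sigma> (i, False) \<otimes>\<^bsub>dihedral n\<^esub> \<sigma> (0, True)" using that by (intro mult) auto
    finally show ?thesis using rot[OF that] t by (simp add: mod_simps)
  qed
  \<comment> \<open>Otherwise every image is a rotation, against surjectivity.\<close>
  have c
  proof (rule ccontr)
    assume "\<not> c"
    have "(0, True) \<in> \<sigma> ` ?C" unfolding surj using assms(1) by simp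
    then obtain i d where "i < n" "\<sigma> (i, d) = (0, True)" by auto
    thus False using rot refl \<open>\<not> c\<close> by (cases d) auto
  qed
  \<comment> \<open>The preimage of \<open>(1, False)\<close> is a rotation, and its exponent
    inverts \<open>r\<close> modulo \<open>n\<close>.\<close>
  have "coprime r n"
  proof -
    have "(1, False) \<in> \<sigma> ` ?C" unfolding surj using assms(1) by simp
    then obtain i d where id: "i < n" "\<sigma> (i, d) = (1, False)" by auto
    hence "r * i mod n = 1" using rot refl \<open>c\<close> by (cases d) auto
    hence "[r * i = 1] (mod n)" using assms(1) by (simp add: cong_def)
    thus ?thesis by (auto simp: coprime_iff_invertible_nat)
  qed
  moreover from this have "r \<ge> 1" using assms(1) by (cases r) auto
  \<comment> \<open>The trivial translation is represented by \<open>n\<close> instead of 0,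
    matching the range over which gcds with \<open>n\<close> are counted.\<close>
  moreover define t' where "t' = (if t = 0 then n else t)"
  have "t' \<in> {0<..n}" using t assms(1) by (simp add: t'_def)
  moreover have "\<sigma> = restrict (dih_aut n r t') ?C"
  proof
    fix x
    show "\<sigma> x = restrict (dih_aut n r t') ?C x"
    proof (cases "x \<in> ?C")
      case True
      then obtain i d where "x = (i, d)" "i < n" by auto
      thus ?thesis using True rot[of i] refl[of i] \<open>c\<close> by (cases d) (auto simp: t'_def)
    next
      case False
      thus ?thesis using extensional_arb[OF ext False] by (simp only: restrict_apply if_False)
    qed
  qed
  ultimately show thesis using r(2) by (intro that[of r t']) auto
qed

lemma bij_betw_auto_dihedral:
  assumes "n > 2"
  shows "bij_betw (\<lambda>(r, t). restrict (dih_aut n r t) (carrier (dihedral n)))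
    ({r. 1 \<le> r \<and> r \<le> n - 1 \<and> coprime r n} \<times> {0<..n}) (auto (dihedral n))"
    (is "bij_betw ?f ?I _")
proof (rule bij_betw_imageI)
  show "inj_on ?f ?I"
  proof (rule inj_onI, clarify)
    fix r t r' t'
    assume r: "1 \<le> r" "r \<le> n - 1" "1 \<le> r'" "r' \<le> n - 1" and t: "t \<in> {0<..n}" "t' \<in> {0<..n}"
      and eq: "restrict (dih_aut n r t) (carrier (dihedral n))
        = restrict (dih_aut n r' t') (carrier (dihedral n))"
    have "r mod n = r' mod n" using fun_cong[OF eq, of "(1, False)"] assms by simp
    moreover have "t mod n = t' mod n" using fun_cong[OF eq, of "(0, True)"] assms by simp
    hence "t = t'" using t by (cases "t = n"; cases "t' = n") auto
    ultimately show "r = r' \<and> t = t'" using r assms by simp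
  qed
  show "?f ` ?I = auto (dihedral n)"
  proof (intro equalityI subsetI)
    fix \<sigma> assume "\<sigma> \<in> ?f ` ?I"
    thus "\<sigma> \<in> auto (dihedral n)" using restrict_dih_aut_in_auto assms by auto
  next
    fix \<sigma> assume "\<sigma> \<in> auto (dihedral n)"
    from auto_dihedral_cases[OF assms this] obtain r t where
      "1 \<le> r" "r \<le> n - 1" "coprime r n" "t \<in> {0<..n}"
      "\<sigma> = restrict (dih_aut n r t) (carrier (dihedral n))" .
    thus "\<sigma> \<in> ?f ` ?I" by (intro image_eqI[of _ _ "(r, t)"]) auto
  qed
qed

section \<open>Assembling the orbit count\<close>

lemma totient_eq_card_coprime_less:
  assumes "n > 1"
  shows "card {r. 1 \<le> r \<and> r \<le> n - 1 \<and> coprime r n} = totient n"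
proof -
  have "r \<le> n - 1" if "r \<in> totatives n" for r
    using totatives_less[OF that assms] by simp
  hence "{r. 1 \<le> r \<and> r \<le> n - 1 \<and> coprime r n} = totatives n"
    by (auto simp: in_totatives_iff)
  thus ?thesis by (simp add: totient_def)
qed

text \<open>Rotations and reflections are separately invariant, and the action on rotations does not
  involve \<open>t\<close>, so 0 may stand in for it there.\<close>

lemma num_cycles_dihedral:
  assumes "n > 1" "coprime r n"
  shows "num_cycles (carrier (dihedral n) - {\<one>\<^bsub>dihedral n\<^esub>}) (restrict (dih_aut n r t) (carrier (dihedral n)))
    = num_cycles (dih_U n) (dih_aut n r 0) + num_cycles (dih_V n) (dih_aut n r t)"
proof -
  have UV: "carrier (dihedral n) - {\<one>\<^bsub>dihedral n\<^esub>} = dih_U n \<union> dih_V n" (is "?C = _")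
    by (auto simp: dih_U_def dih_V_def)
  have bijU: "bij_betw (dih_aut n r s) (dih_U n) (dih_U n)" for s
    using assms by (intro bij_betw_dih_aut_U) auto
  have bijV: "bij_betw (dih_aut n r t) (dih_V n) (dih_V n)"
    using assms by (intro bij_betw_dih_aut_V) auto
  have "num_cycles ?C (restrict (dih_aut n r t) (carrier (dihedral n))) = num_cycles ?C (dih_aut n r t)"
  proof (rule num_cycles_cong[symmetric])
    show "dih_aut n r t ` ?C \<subseteq> ?C"
      unfolding UV image_Un bij_betw_imp_surj_on[OF bijU] bij_betw_imp_surj_on[OF bijV] by simp
  qed simp
  also have "\<dots> = num_cycles (dih_U n) (dih_aut n r t) + num_cycles (dih_V n) (dih_aut n r t)"
    unfolding UV
    by (intro num_cycles_Un finite_dih_U finite_dih_V bijU bijV) (auto simp: dih_U_def dih_V_def)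
  also have "num_cycles (dih_U n) (dih_aut n r t) = num_cycles (dih_U n) (dih_aut n r 0)"
    by (rule num_cycles_cong, simp only: bij_betw_imp_surj_on[OF bijU]) (auto simp: dih_U_def)
  finally show ?thesis .
qed

text \<open>Each divisor \<open>d\<close> of \<open>n\<close> is \<open>gcd t n\<close> for exactly
  \<open>totient (n div d)\<close> of the numbers \<open>t\<close> from 1 to
  \<open>n\<close>.\<close>

lemma sum_gcd_eq_sum_divisors:
  fixes f :: "nat \<Rightarrow> real"
  assumes "n > 0"
  shows "(\<Sum>t\<in>{0<..n}. f (gcd t n)) = (\<Sum>t\<in>{t. t > 0 \<and> t dvd n}. real (totient (n div t)) * f t)"
proof -
  have "(\<Sum>t\<in>{0<..n}. f (gcd t n)) =
      (\<Sum>d\<in>{t. t > 0 \<and> t dvd n}. real (card {t \<in> {0<..n}. gcd t n = d}) * f d)"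
    using assms by (intro sum_fun_comp) auto
  also have "\<dots> = (\<Sum>t\<in>{t. t > 0 \<and> t dvd n}. real (totient (n div t)) * f t)"
    by (intro sum.cong refl) (simp only: card_gcd_eq_totient[OF assms] mem_Collect_eq)
  finally show ?thesis .
qed

theorem theorem4p5:
  fixes n :: nat
  assumes "n > 2"
    and "DCI_group (dihedral n)"
  shows "num_cayley_classes (dihedral n) = num_aut_orbits (dihedral n)
    \<and> real (num_aut_orbits (dihedral n)) =
        1 / (real n * real (totient n)) *
        (\<Sum>t\<in>{t. t > 0 \<and> t dvd n}. real (totient (n div t)) *
           (\<Sum>r\<in>{r. 1 \<le> r \<and> r \<le> n - 1 \<and> coprime r n}.
              2 ^ (num_cycles (dih_U n) (dih_aut n r 0) + num_cycles (dih_V n) (dih_aut n r t))))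
    \<and> (\<forall>t r. t > 0 \<and> t dvd n \<and> 1 \<le> r \<and> r \<le> n - 1 \<and> coprime r n \<longrightarrow>
         real (num_cycles (dih_U n) (dih_aut n r 0)) =
           (\<Sum>d\<in>{d. d > 1 \<and> d dvd n}. real (totient d) / real (mord d r))
       \<and> real (num_cycles (dih_V n) (dih_aut n r t)) =
           (\<Sum>(d, l)\<in>{(d, l). d > 0 \<and> l > 0 \<and> d dvd n
                  \<and> l dvd (mord n r div gcd (kappa d r t) (mord n r))
                  \<and> gcd (r ^ (l * kappa d r t) - 1) n = d}.
              real d / real (kappa n r t) *
              real (totient (mord n r div (l * gcd (kappa d r t) (mord n r))))))"
proof (intro conjI allI impI)
  interpret group "dihedral n" using assms(1) by (intro group_dihedral) simp
  show "num_cayley_classes (dihedral n) = num_aut_orbits (dihedral n)"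
    by (rule num_cayley_classes_eq_num_aut_orbits[OF assms(2)])
  have n: "n > 1" "n > 0" using assms(1) by auto
  define R where "R = {r. 1 \<le> r \<and> r \<le> n - 1 \<and> coprime r n}"
  \<comment> \<open>The contribution of a single translation \<open>t\<close>, summed over all
    multipliers; \<open>w_gcd\<close> makes it a function of \<open>gcd t n\<close>.\<close>
  define w :: "nat \<Rightarrow> real" where "w t = (\<Sum>r\<in>R.
    2 ^ (num_cycles (dih_U n) (dih_aut n r 0) + num_cycles (dih_V n) (dih_aut n r t)))" for t
  note bij = bij_betw_auto_dihedral[OF assms(1), folded R_def]
  have w_gcd: "w (gcd t n) = w t" for t
    unfolding w_def R_def using num_cycles_V_gcd[OF n(1)] by (intro sum.cong) auto
  have card_auto: "card (auto (dihedral n)) = totient n * n"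
    using bij_betw_same_card[OF bij] totient_eq_card_coprime_less[OF n(1), folded R_def]
    by (simp add: card_cartesian_product)
  have "real (num_aut_orbits (dihedral n)) * (real n * real (totient n))
      = real (num_aut_orbits (dihedral n) * card (auto (dihedral n)))"
    by (simp add: card_auto)
  also have "\<dots> = (\<Sum>\<sigma>\<in>auto (dihedral n). 2 ^ num_cycles (carrier (dihedral n) - {\<one>\<^bsub>dihedral n\<^esub>}) \<sigma>)"
    by (subst burnside_num_aut_orbits) simp_all
  also have "\<dots> = (\<Sum>(r, t)\<in>R \<times> {0<..n}.
      2 ^ (num_cycles (dih_U n) (dih_aut n r 0) + num_cycles (dih_V n) (dih_aut n r t)))"
    \<comment> \<open>Burnside's sum over automorphisms becomes a sum over the parameter pairs
      \<open>(r, t)\<close>.\<close>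
    unfolding sum.reindex_bij_betw[OF bij, symmetric]
    by (intro sum.cong refl) (auto simp: R_def num_cycles_dihedral[OF n(1)] simp del: dihedral_simps)
  also have "\<dots> = (\<Sum>t\<in>{0<..n}. w t)"
    unfolding w_def by (subst sum.swap) (simp add: sum.cartesian_product)
  also have "\<dots> = (\<Sum>t\<in>{t. t > 0 \<and> t dvd n}. real (totient (n div t)) * w t)"
    using sum_gcd_eq_sum_divisors[OF n(2), of w] by (simp add: w_gcd)
  finally have "real (num_aut_orbits (dihedral n)) * (real n * real (totient n))
      = (\<Sum>t\<in>{t. t > 0 \<and> t dvd n}. real (totient (n div t)) * w t)" .
  moreover have "real n * real (totient n) \<noteq> 0" using n by simp
  ultimately show "real (num_aut_orbits (dihedral n)) = 1 / (real n * real (totient n)) *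
      (\<Sum>t\<in>{t. t > 0 \<and> t dvd n}. real (totient (n div t)) *
         (\<Sum>r\<in>{r. 1 \<le> r \<and> r \<le> n - 1 \<and> coprime r n}.
            2 ^ (num_cycles (dih_U n) (dih_aut n r 0) + num_cycles (dih_V n) (dih_aut n r t))))"
    unfolding w_def R_def by (simp add: field_simps)
next
  fix t r assume "t > 0 \<and> t dvd n \<and> 1 \<le> r \<and> r \<le> n - 1 \<and> coprime r n"
  thus "real (num_cycles (dih_U n) (dih_aut n r 0)) =
      (\<Sum>d\<in>{d. d > 1 \<and> d dvd n}. real (totient d) / real (mord d r))"
    using assms(1) by (intro num_cycles_U) auto
next
  fix t r assume "t > 0 \<and> t dvd n \<and> 1 \<le> r \<and> r \<le> n - 1 \<and> coprime r n"
  thus "real (num_cycles (dih_V n) (dih_aut n r t)) =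
      (\<Sum>(d, l)\<in>{(d, l). d > 0 \<and> l > 0 \<and> d dvd n
             \<and> l dvd (mord n r div gcd (kappa d r t) (mord n r))
             \<and> gcd (r ^ (l * kappa d r t) - 1) n = d}.
         real d / real (kappa n r t) *
         real (totient (mord n r div (l * gcd (kappa d r t) (mord n r)))))"
    using assms(1) by (intro num_cycles_V) auto
qed

end
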